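(* Let $\mathcal{A}\subset\mathbb{Z}$ be a finite alphabet, let $G=(V,E)$ be a finite directed graph with edge labelling $\ell:E\to\mathcal{A}$ with $M=\sum_{a\in\mathcal{A}}M_a$ primitive, let $\beta>1$ be a Pisot number, and let $\nu=(\phi^+)_*(\mu^+)$ as in the context. Then $\nu$ is absolutely continuous with respect to Lebesgue measure if and only if $$\lim_{k\to\infty}\widehat{\nu}(z\beta^k)=0\quad\text{for all }z\in\mathbb{Z}[\beta]\setminus\{0\}.$$
   Context: For $a\in\mathcal{A}$, $M_a$ is the $V\times V$ matrix with $(M_a)_{ij}=1$ if $(i,j)\in E$ and $\ell((i,j))=a$, and $0$ otherwise. By Perron–Frobenius, $M$ has a dominant eigenvalue $\lambda>0$ with positive left eigenvector $\mathbf v_L$ and right eigenvector $\mathbf v_R$, normalised by $\mathbf v_L^{\mathsf T}\mathbf v_R=1$. $\mathcal{K}^+\subseteq\mathcal{A}^{\mathbb{N}}$ is the set of sequences $(\ell(e_k))_{k\ge1}$ for infinite paths $e_1e_2\ldots$ in $G$ (terminal vertex of $e_j$ equals initial vertex of $e_{j+1}$), and $\mu^+$ the Borel probability measure on $\mathcal{K}^+$ with $\mu^+(\{x:x_1=\varepsilon_1,\ldots,x_k=\varepsilon_k\})=\lambda^{-k}\mathbf v_L^{\mathsf T}M_{\varepsilon_1}\cdots M_{\varepsilon_k}\mathbf v_R$. A Pisot number is an algebraic integer $>1$ all of whose other Galois conjugates have modulus $<1$ (integers $\ge2$ included). $\phi^+((x_k)_{k\ge1})=\sum_{k\ge1}x_k\beta^{-k}$,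 $\nu(A)=\mu^+((\phi^+)^{-1}(A))$, and $\widehat{\nu}(t)=\int e^{-2\pi i x t}\,d\nu(x)$. *)

theory Defs
  imports "HOL-Probability.Probability" "HOL-Computational_Algebra.Polynomial"
begin

(* Vertices: a finite type 'v (V = UNIV).  Matrices indexed by V are functions 'v => 'v => real. *)

definition label_mat :: "('v \<times> 'v) set \<Rightarrow> ('v \<times> 'v \<Rightarrow> int) \<Rightarrow> int \<Rightarrow> 'v \<Rightarrow> 'v \<Rightarrow> real" where
  "label_mat E lab a i j = (if (i, j) \<in> E \<and> lab (i, j) = a then 1 else 0)"

definition total_mat :: "int set \<Rightarrow> ('v \<times> 'v) set \<Rightarrow> ('v \<times> 'v \<Rightarrow> int) \<Rightarrow> 'v \<Rightarrow> 'v \<Rightarrow> real" where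
  "total_mat A E lab i j = (\<Sum>a\<in>A. label_mat E lab a i j)"

definition mat_mult :: "('v::finite \<Rightarrow> 'v \<Rightarrow> real) \<Rightarrow> ('v \<Rightarrow> 'v \<Rightarrow> real) \<Rightarrow> 'v \<Rightarrow> 'v \<Rightarrow> real" where
  "mat_mult P Q i j = (\<Sum>k\<in>UNIV. P i k * Q k j)"

fun mat_pow :: "('v::finite \<Rightarrow> 'v \<Rightarrow> real) \<Rightarrow> nat \<Rightarrow> 'v \<Rightarrow> 'v \<Rightarrow> real" where
  "mat_pow P 0 = (\<lambda>i j. if i = j then 1 else 0)"
| "mat_pow P (Suc n) = mat_mult (mat_pow P n) P"

definition primitive_mat :: "('v::finite \<Rightarrow> 'v \<Rightarrow> real) \<Rightarrow> bool" where
  "primitive_mat P \<longleftrightarrow> (\<forall>i j. P i j \<ge> 0) \<and> (\<exists>k>0. \<forall>i j. mat_pow P k i j > 0)"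

definition row_mult :: "('v::finite \<Rightarrow> real) \<Rightarrow> ('v \<Rightarrow> 'v \<Rightarrow> real) \<Rightarrow> 'v \<Rightarrow> real" where
  "row_mult u P j = (\<Sum>i\<in>UNIV. u i * P i j)"

definition word_weight :: "('v::finite \<times> 'v) set \<Rightarrow> ('v \<times> 'v \<Rightarrow> int) \<Rightarrow> ('v \<Rightarrow> real) \<Rightarrow> ('v \<Rightarrow> real) \<Rightarrow> int list \<Rightarrow> real" where
  "word_weight E lab vL vR ws = (\<Sum>j\<in>UNIV. (foldl (\<lambda>u a. row_mult u (label_mat E lab a)) vL ws) j * vR j)"

definition pisot :: "real \<Rightarrow> bool" where
  "pisot \<beta> \<longleftrightarrow> \<beta> > 1 \<and> (\<exists>p :: int poly. lead_coeff p = 1 \<and> irreducible p \<and>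
      poly (map_poly real_of_int p) \<beta> = 0 \<and>
      (\<forall>z::complex. poly (map_poly complex_of_int p) z = 0 \<and> z \<noteq> complex_of_real \<beta> \<longrightarrow> cmod z < 1))"

definition Zbeta :: "real \<Rightarrow> real set" where
  "Zbeta \<beta> = {poly (map_poly real_of_int p) \<beta> | p :: int poly. True}"

(* sequence space A^N with product sigma algebra; index shifted: x 0 = x_1 *)
definition seq_space :: "(nat \<Rightarrow> int) measure" where
  "seq_space = PiM UNIV (\<lambda>_. count_space UNIV)"

definition phi_plus :: "real \<Rightarrow> (nat \<Rightarrow> int) \<Rightarrow> real" where
  "phi_plus \<beta> x = (\<Sum>k. real_of_int (x k) / \<beta> ^ Suc k)"

definition fourier :: "real measure \<Rightarrow> real \<Rightarrow> complex" where
  "fourier \<nu> t = (\<integral>x. cis (- (2 * pi * x * t)) \<partial>\<nu>)"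

end

(* Riemann-Lebesgue gives one direction. For the other, \<beta>^k phi_plus x is an element of Z[\<beta>]
   plus phi_plus of the shifted sequence. Since \<beta> is Pisot, elements of Z[\<beta>] are seen modulo
   integers only through their conjugates, which stay bounded. Hence, if phi_plus of the shifted
   sequence lies in an interval of length about 1/n, the point (\<beta>^(k+i) phi_plus x) for i = 0, ..., e
   of the torus of dimension e + 1 (the degree of \<beta>) lies in a 1/n-neighbourhood of a bounded piece
   of a hyperplane, covered by O(n^e) cubes of side 1/n. The hypothesis says that these points
   equidistribute, so by a Fejer kernel estimate each cube has limiting mass O(n^(-e-1)). By
   stationarity the interval has mass O(1/n), so the measure has a bounded density. *)

theory Submission
  imports Defs "HOL-Computational_Algebra.Computational_Algebra"
begin

section \<open>Linear recurrences and the trace sequence of a Pisot number\<close>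

text \<open>The dimension count decides everything: a cube in the torus of dimension e + 1 has
  limiting mass O(n^(-e-1)), and a bounded set with no further structure would need about n^(e+1)
  cubes, leaving no gain. The saved power of n comes from a linear relation obeyed by the conjugate
  part alone, the recurrence of order e obtained by dividing the factor X - \<beta> out of the
  minimal polynomial p. No field embeddings are formed: an integer sequence equal to \<beta>^m plus
  a summable error stands in for the traces. The decay hypothesis carries no rate, so only finitely
  many frequencies can be used at once. Hence n is fixed while k tends to infinity, and the interval
  mass survives the limit because stationarity makes it independent of k. The frequencies that occur
  are differences of integer vectors paired with 1, ..., \<beta>^e; these are nonzero elements of
  Z[\<beta>] because the powers are independent over the integers.\<close>

definition shift_act :: "'a::comm_ring_1 poly \<Rightarrow> (nat \<Rightarrow> 'a) \<Rightarrow> nat \<Rightarrow> 'a" where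
  "shift_act P u n = (\<Sum>i\<le>degree P. coeff P i * u (n + i))"

lemma shift_act_eq_sum:
  assumes "degree P \<le> N"
  shows "shift_act P u n = (\<Sum>i\<le>N. coeff P i * u (n + i))"
  unfolding shift_act_def
  by (rule sum.mono_neutral_left) (use assms in \<open>auto simp: coeff_eq_0\<close>)

lemma shift_act_pCons: "shift_act (pCons a P) u n = a * u n + shift_act P u (Suc n)"
proof -
  have "shift_act (pCons a P) u n = (\<Sum>i\<le>Suc (degree P). coeff (pCons a P) i * u (n + i))"
    by (rule shift_act_eq_sum) (rule degree_pCons_le)
  also have "\<dots> = a * u n + (\<Sum>i\<le>degree P. coeff P i * u (n + Suc i))"
    by (subst sum.atMost_Suc_shift) simp
  finally show ?thesis by (simp add: shift_act_def)
qed

lemma shift_act_0 [simp]: "shift_act 0 u n = 0"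
  by (simp add: shift_act_def)

lemma shift_act_diff_smult:
  "shift_act (P - smult b Q) u n = shift_act P u n - b * shift_act Q u n"
proof -
  define N where "N = max (degree P) (degree Q)"
  have "degree (P - smult b Q) \<le> N"
    unfolding N_def by (meson degree_diff_le_max degree_smult_le le_max_iff_disj max.coboundedI2 order_trans max.mono order_refl)
  then show ?thesis
    by (simp add: shift_act_eq_sum[of _ N] N_def algebra_simps sum_subtractf sum_distrib_left)
qed

text \<open>With S the shift of sequences, \<open>shift_act P u\<close> is P(S) u. Splitting off a
  root b thus leaves a first-order recurrence for Q(S) u with multiplier b and inhomogeneity P(S)
  u.\<close>

lemma shift_act_linear_mult:
  "shift_act ([:- b, 1:] * Q) u n = shift_act Q u (Suc n) - b * shift_act Q u n"
proof -
  have "[:- b, 1:] * Q = pCons 0 Q - smult b Q"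
    by simp
  then show ?thesis
    by (simp only: shift_act_diff_smult shift_act_pCons) simp
qed

lemma shift_act_add_seq: "shift_act P (\<lambda>i. u i + v i) n = shift_act P u n + shift_act P v n"
  by (simp add: shift_act_def algebra_simps sum.distrib)

lemma shift_act_mult_seq: "shift_act P (\<lambda>i. c * u i) n = c * shift_act P u n"
  by (simp add: shift_act_def algebra_simps sum_distrib_left)

lemma shift_act_power: "shift_act P (\<lambda>i. b ^ i) n = b ^ n * poly P b"
  by (simp add: shift_act_def poly_altdef algebra_simps power_add sum_distrib_left)

text \<open>Summing the triangle inequality for the recurrence up to N, the term with factor
  \<open>norm a\<close> < 1 is absorbed on the left, which bounds all partial sums.\<close>

lemma summable_norm_first_order:
  fixes u v :: "nat \<Rightarrow> complex"
  assumes a: "norm a < 1" and rec: "\<And>n. u (Suc n) = a * u n + v n" and v: "summable (\<lambda>n. norm (v n))"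
  shows "summable (\<lambda>n. norm (u n))"
proof (rule summableI_nonneg_bounded)
  fix N
  have *: "(\<Sum>n<N. norm (u n)) \<le> norm (u 0) + norm a * (\<Sum>n<N. norm (u n)) + (\<Sum>n<N. norm (v n))" for N
  proof (induction N)
    case (Suc N)
    have "norm (u (Suc n)) \<le> norm a * norm (u n) + norm (v n)" for n
      unfolding rec using norm_triangle_ineq[of "a * u n" "v n"] by (simp add: norm_mult)
    then have "(\<Sum>n<N. norm (u (Suc n))) \<le> (\<Sum>n<N. norm a * norm (u n) + norm (v n))"
      by (intro sum_mono) auto
    also have "\<dots> \<le> (\<Sum>n<Suc N. norm a * norm (u n) + norm (v n))"
      by simp
    also have "\<dots> = norm a * (\<Sum>n<Suc N. norm (u n)) + (\<Sum>n<Suc N. norm (v n))"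
      by (simp only: sum.distrib sum_distrib_left)
    finally show ?case
      unfolding sum.lessThan_Suc_shift[of "\<lambda>n. norm (u n)" N] by (simp add: sum.lessThan_Suc_shift)
  qed simp
  have "(\<Sum>n<N. norm (v n)) \<le> (\<Sum>n. norm (v n))"
    by (rule sum_le_suminf[OF v]) auto
  with *[of N] have "(1 - norm a) * (\<Sum>n<N. norm (u n)) \<le> norm (u 0) + (\<Sum>n. norm (v n))"
    by (simp add: algebra_simps)
  then show "(\<Sum>n<N. norm (u n)) \<le> (norm (u 0) + (\<Sum>n. norm (v n))) / (1 - norm a)"
    using a by (simp add: field_simps)
qed simp

text \<open>One root is peeled off at a time. Repeated roots cause no trouble, since no closed form
  of the solutions enters.\<close>

lemma summable_of_shift_act:
  fixes P :: "complex poly"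
  assumes "P \<noteq> 0" and "\<And>z. poly P z = 0 \<Longrightarrow> norm z < 1"
    and "summable (\<lambda>n. norm (shift_act P u n))"
  shows "summable (\<lambda>n. norm (u n))"
  using assms
proof (induction "degree P" arbitrary: P)
  case 0
  then obtain c where c: "P = [:c:]" "c \<noteq> 0"
    by (metis degree_eq_zeroE pCons_0_0)
  then have "summable (\<lambda>n. norm c * norm (u n))"
    using 0 by (simp add: shift_act_pCons norm_mult)
  then show ?case
    using c by (simp add: summable_cmult_iff)
next
  case (Suc d)
  then obtain a where a: "poly P a = 0"
    by (metis fundamental_theorem_of_algebra constant_degree nat.distinct(1))
  then obtain Q where Q: "P = [:- a, 1:] * Q"
    by (metis dvdE poly_eq_0_iff_dvd)
  have "Q \<noteq> 0" using Suc Q by auto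
  have dQ: "d = degree Q"
    using Suc(2) \<open>Q \<noteq> 0\<close> unfolding Q by (subst (asm) degree_mult_eq) auto
  have "summable (\<lambda>n. norm (shift_act Q u n))"
  proof (rule summable_norm_first_order)
    show "norm a < 1" using Suc a by auto
    show "summable (\<lambda>n. norm (shift_act P u n))" by fact
    show "shift_act Q u (Suc n) = a * shift_act Q u n + shift_act P u n" for n
      unfolding Q shift_act_linear_mult by simp
  qed
  then show ?case
    using Suc(1)[OF dQ \<open>Q \<noteq> 0\<close>] Suc(4) unfolding Q by auto
qed

text \<open>The fundamental solution, with initial values 0, ..., 0, 1. There is no division by the
  leading coefficient, so the values are integers and the recurrence holds for monic
  \<open>p\<close>.\<close>

function impulse :: "int poly \<Rightarrow> nat \<Rightarrow> int" where
  "impulse p n = (if n < degree p then (if Suc n = degree p then 1 else 0)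
     else - (\<Sum>i<degree p. coeff p i * impulse p (n - degree p + i)))"
  by auto
termination by (relation "Wellfounded.measure snd") auto

declare impulse.simps [simp del]

lemma shift_act_impulse:
  assumes "lead_coeff p = 1"
  shows "shift_act p (impulse p) n = 0"
proof -
  have "impulse p (n + degree p) = - (\<Sum>i<degree p. coeff p i * impulse p (n + i))"
    by (subst impulse.simps) simp
  then show ?thesis
    using assms by (simp add: shift_act_def lessThan_Suc_atMost[symmetric])
qed


section \<open>Integer polynomials evaluated at an algebraic number\<close>

lemma poly_of_int_smult:
  "poly (map_poly of_int (smult a p)) x = of_int a * poly (map_poly of_int p) (x::'a::{comm_ring_1,ring_char_0})"
  by (simp add: map_poly_smult)

lemma poly_of_int_add:
  "poly (map_poly of_int (p + q)) x =
    poly (map_poly of_int p) x + poly (map_poly of_int q) (x::'a::{comm_ring_1,ring_char_0})"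
proof -
  have "map_poly of_int (p + q) = map_poly of_int p + (map_poly of_int q :: 'a poly)"
    by (intro poly_eqI) (simp add: coeff_map_poly)
  then show ?thesis by simp
qed

lemma poly_of_int_mult:
  "poly (map_poly of_int (p * q)) x =
    poly (map_poly of_int p) x * poly (map_poly of_int q) (x::'a::{comm_ring_1,ring_char_0})"
  by (induction p) (simp_all add: map_poly_pCons poly_of_int_smult poly_of_int_add algebra_simps)

lemma poly_of_int_of_real:
  "poly (map_poly of_int p) (complex_of_real x) = of_real (poly (map_poly of_int p) x)"
  by (induction p) (simp_all add: map_poly_pCons)

text \<open>Let s have least degree among the nonzero integer polynomials vanishing at x.
  Pseudo-division of p by s, which stays inside \<open>int poly\<close>, leaves a remainder that
  vanishes at x, hence is zero: a * p = s * q with a constant a. Being prime, p divides q because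
  its degree exceeds that of s. Cancelling p makes s a divisor of a, so s is a nonzero constant and
  cannot vanish at x.\<close>

lemma int_poly_minimal:
  fixes p r :: "int poly" and x :: real
  assumes p: "irreducible p" and px: "poly (map_poly of_int p) x = 0"
    and deg: "degree r < degree p" and rx: "poly (map_poly of_int r) x = 0"
  shows "r = 0"
proof (rule ccontr)
  assume "r \<noteq> 0"
  let ?R = "\<lambda>r. r \<noteq> 0 \<and> poly (map_poly real_of_int r) x = 0"
  obtain s where s: "?R s" and min: "\<And>t. ?R t \<Longrightarrow> degree s \<le> degree t"
    using ex_has_least_nat[of ?R r degree] rx \<open>r \<noteq> 0\<close> by auto
  have "degree s < degree p"
    using min[of r] rx \<open>r \<noteq> 0\<close> deg by simp
  define t where "t = pseudo_mod p s"
  obtain a q where aq: "a \<noteq> 0" "smult a p = s * q + t"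
    using pseudo_mod(1)[of s p] s unfolding t_def by auto
  have t: "t = 0 \<or> degree t < degree s"
    using pseudo_mod(2)[of s p] s unfolding t_def by auto
  have "poly (map_poly real_of_int (smult a p)) x = poly (map_poly real_of_int (s * q + t)) x"
    using aq by simp
  then have "poly (map_poly real_of_int t) x = 0"
    using s px by (simp add: poly_of_int_add poly_of_int_mult poly_of_int_smult)
  with t min[of t] have "t = 0"
    using linorder_not_le by blast
  with aq have eq: "smult a p = s * q" by simp
  have "prime_elem p"
    using p by (rule irreducible_imp_prime_elem)
  moreover have "p dvd s * q"
    by (metis eq dvd_smult dvd_refl)
  moreover have "\<not> p dvd s"
    using \<open>degree s < degree p\<close> s dvd_imp_degree_le[of p s] by auto
  ultimately obtain q' where q': "q = p * q'"
    by (meson prime_elem_dvd_mult_iff dvdE)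
  have "p \<noteq> 0" using p by auto
  have "p * [:a:] = p * (s * q')"
    using eq q' by (simp add: algebra_simps)
  then have sq: "[:a:] = s * q'"
    using \<open>p \<noteq> 0\<close> by (subst (asm) mult_cancel_left) blast
  then have "degree s = 0"
    using aq(1) by (metis degree_pCons_0 degree_mult_eq add_is_0 mult_eq_0_iff pCons_eq_0_iff)
  then obtain c where "s = [:c:]"
    by (metis degree_eq_zeroE)
  then show False using s by (simp add: map_poly_pCons)
qed

text \<open>For \<open>Q = p / (X - b)\<close>, evaluating \<open>Q\<close> at time 0 maps integer solutions of the recurrence with
  characteristic polynomial \<open>p\<close> onto \<open>\<int>[b]\<close>: the impulse goes to 1, and a shift multiplies by \<open>b\<close>.\<close>

lemma recurrence_with_prescribed_value:
  fixes p r :: "int poly" and b :: complex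
  assumes monic: "lead_coeff p = 1" and Q: "map_poly of_int p = [:- b, 1:] * Q"
  shows "\<exists>g :: nat \<Rightarrow> int. (\<forall>n. shift_act p g n = 0) \<and>
    shift_act Q (\<lambda>n. of_int (g n)) 0 = poly (map_poly of_int r) b"
proof (induction r)
  case 0
  show ?case by (rule exI[of _ "\<lambda>_. 0"]) (simp add: shift_act_def)
next
  case (pCons a r)
  have of_int_act: "shift_act (map_poly of_int p) (\<lambda>n. of_int (g n)) n = complex_of_int (shift_act p g n)"
    for g n by (simp add: shift_act_def degree_map_poly coeff_map_poly)
  obtain g where g: "\<And>n. shift_act p g n = 0"
    and g0: "shift_act Q (\<lambda>n. of_int (g n)) 0 = poly (map_poly of_int r) b"
    using pCons by blast
  have [simp]: "Q \<noteq> 0" using Q monic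
    by (metis degree_0 leading_coeff_0_iff lead_coeff_map_poly_nz map_poly_0 mult_zero_right of_int_eq_0_iff one_neq_zero of_int_1)
  have "degree ([:- b, 1:] * Q) = Suc (degree Q)"
    by (subst degree_mult_eq) auto
  then have deg: "degree p = Suc (degree Q)"
    using arg_cong[OF Q, of degree] by (simp add: degree_map_poly)
  have "lead_coeff ([:- b, 1:] * Q) = lead_coeff Q"
    by (subst lead_coeff_mult) simp
  moreover have "lead_coeff (map_poly of_int p :: complex poly) = 1"
    using monic by (simp add: degree_map_poly coeff_map_poly)
  ultimately have lc: "lead_coeff Q = 1" using Q by simp
  have "impulse p i = (if i = degree Q then 1 else 0)" if "i \<le> degree Q" for i
    using that deg impulse.simps[of p i] by simp
  then have "impulse p (degree Q) = 1" "\<And>i. i < degree Q \<Longrightarrow> impulse p i = 0"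
    by simp_all
  then have imp0: "shift_act Q (\<lambda>n. of_int (impulse p n)) 0 = 1"
    using lc by (simp add: shift_act_def lessThan_Suc_atMost[symmetric])
  define h where "h n = a * impulse p n + g (Suc n)" for n
  have sh: "shift_act P (\<lambda>n. f (Suc n)) n = shift_act P f (Suc n)" for P :: "'x::comm_ring_1 poly" and f n
    by (simp add: shift_act_def)
  have "shift_act p h n = 0" for n
    unfolding h_def using shift_act_impulse[OF monic] g
    by (simp add: shift_act_add_seq shift_act_mult_seq sh)
  moreover have "shift_act Q (\<lambda>n. of_int (h n)) 0 = poly (map_poly of_int (pCons a r)) b"
  proof -
    \<comment> \<open>This is (S - b) Q(S) g = p(S) g = 0 at time 0, the reason why a shift
      multiplies the value by b.\<close>
    have "shift_act Q (\<lambda>n. of_int (g n)) (Suc 0) - b * shift_act Q (\<lambda>n. of_int (g n)) 0 = 0"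
      using of_int_act[of g 0] g by (simp only: Q shift_act_linear_mult) simp
    then have "shift_act Q (\<lambda>n. of_int (g (Suc n))) 0 = b * poly (map_poly of_int r) b"
      using g0 sh[of Q "\<lambda>n. of_int (g n)" 0] by simp
    then show ?thesis
      unfolding h_def using imp0
      by (simp add: shift_act_add_seq shift_act_mult_seq map_poly_pCons)
  qed
  ultimately show ?case by blast
qed

text \<open>Here \<open>e\<close> is the degree of \<beta> minus one and \<open>q\<close> holds the
  lower coefficients of Q = p / (X - \<beta>). The error \<open>u\<close> decays if Q(S) kills it,
  since Q has lost the root \<beta>. At time 0, Q(S) sends the powers of \<beta> to Q(\<beta>) =
  p'(\<beta>), so \<open>g\<close> has to take the same value there. That value lies in Z[\<beta>],
  so an integer solution with it exists.\<close>

lemma pisot_trace_sequence: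
  assumes "pisot \<beta>"
  shows "\<exists>(e :: nat) (g :: nat \<Rightarrow> int) (u :: nat \<Rightarrow> real) (q :: nat \<Rightarrow> real).
    (\<forall>m. real_of_int (g m) = \<beta> ^ m + u m) \<and> summable (\<lambda>m. \<bar>u m\<bar>) \<and>
    (\<forall>n. (\<Sum>i<e. q i * u (n + i)) + u (n + e) = 0) \<and>
    (\<forall>m :: nat \<Rightarrow> int. (\<Sum>i\<le>e. of_int (m i) * \<beta> ^ i) = 0 \<longrightarrow> (\<forall>i\<le>e. m i = 0))"
proof -
  obtain p :: "int poly" where monic: "lead_coeff p = 1" and irr: "irreducible p"
    and root: "poly (map_poly of_int p) \<beta> = 0"
    and conj: "\<And>z::complex. poly (map_poly of_int p) z = 0 \<Longrightarrow> z \<noteq> of_real \<beta> \<Longrightarrow> norm z < 1"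
    using assms unfolding pisot_def by blast
  have "p \<noteq> 0" using monic by auto
  let ?P = "map_poly of_int p :: complex poly"
  have P\<beta>: "poly ?P (of_real \<beta>) = 0"
    using root by (simp add: poly_of_int_of_real)
  then obtain Q where Q: "?P = [:- of_real \<beta>, 1:] * Q"
    by (metis dvdE poly_eq_0_iff_dvd)
  have degP: "degree ?P = degree p" by (simp add: degree_map_poly)
  have "?P \<noteq> 0" using \<open>p \<noteq> 0\<close> by (simp add: map_poly_eq_0_iff)
  then have "Q \<noteq> 0" using Q by auto
  have "degree ([:- of_real \<beta>, 1:] * Q) = Suc (degree Q)"
    using \<open>Q \<noteq> 0\<close> by (subst degree_mult_eq) auto
  then have deg: "degree p = Suc (degree Q)"
    using degP Q by simp
  have "lead_coeff ([:- of_real \<beta>, 1:] * Q) = lead_coeff Q"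
    by (subst lead_coeff_mult) simp
  moreover have "lead_coeff ?P = 1"
    using monic by (simp add: degree_map_poly coeff_map_poly)
  ultimately have lc: "lead_coeff Q = 1" using Q by simp
  have min: "r = 0" if "degree r \<le> degree Q" "poly (map_poly of_int r) \<beta> = 0" for r
    by (rule int_poly_minimal[OF irr root]) (use that deg in auto)
  have pd: "map_poly of_int (pderiv p) = pderiv ?P"
    by (intro poly_eqI) (simp add: coeff_map_poly coeff_pderiv)
  then have Q\<beta>: "poly Q (of_real \<beta>) = poly (map_poly of_int (pderiv p)) (of_real \<beta>)"
    unfolding pd Q by (simp only: pderiv_mult poly_add poly_mult) (simp add: pderiv_pCons)
  \<comment> \<open>By minimality of p, its derivative cannot vanish at \<beta>. So \<beta> is a
    simple root of p, and every root of Q is one of the other conjugates.\<close>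
  have "pderiv p \<noteq> 0" "degree (pderiv p) \<le> degree Q"
    using deg by (auto simp: pderiv_eq_0_iff degree_pderiv)
  then have "poly Q (of_real \<beta>) \<noteq> 0"
    using min[of "pderiv p"] unfolding Q\<beta> poly_of_int_of_real by auto
  then have Qroot: "norm z < 1" if "poly Q z = 0" for z
    using that conj[of z] Q by auto
  obtain g :: "nat \<Rightarrow> int" where g: "\<And>n. shift_act p g n = 0"
    and g0: "shift_act Q (\<lambda>n. of_int (g n)) 0 = poly Q (of_real \<beta>)"
    using recurrence_with_prescribed_value[OF monic Q, of "pderiv p"] Q\<beta> by auto
  define u where "u m = real_of_int (g m) - \<beta> ^ m" for m
  let ?U = "\<lambda>m. complex_of_real (u m)"
  have U: "?U = (\<lambda>m. of_int (g m) + (-1) * of_real \<beta> ^ m)"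
    by (auto simp: u_def)
  have "shift_act ?P (\<lambda>n. of_int (g n)) n = complex_of_int (shift_act p g n)" for n
    by (simp add: shift_act_def degree_map_poly coeff_map_poly)
  then have "shift_act ?P ?U n = 0" for n
    unfolding U shift_act_add_seq shift_act_mult_seq shift_act_power using g P\<beta> by simp
  \<comment> \<open>Since (S - \<beta>) Q(S) u = p(S) u = 0, the sequence Q(S) u is geometric with
    ratio \<beta>. It vanishes as soon as its initial value does, and \<open>g0\<close> was
    prescribed for that.\<close>
  then have rec: "shift_act Q ?U (Suc n) = of_real \<beta> * shift_act Q ?U n" for n
    by (simp only: Q shift_act_linear_mult) simp
  have zero: "shift_act Q ?U n = 0" for n
  proof (induction n)
    case 0
    show ?case
      unfolding U shift_act_add_seq shift_act_mult_seq shift_act_power using g0 by simp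
  qed (simp add: rec)
  show ?thesis
  proof (intro exI conjI allI)
    show "real_of_int (g m) = \<beta> ^ m + u m" for m by (simp add: u_def)
    have "summable (\<lambda>n. norm (?U n))"
      by (rule summable_of_shift_act[OF \<open>Q \<noteq> 0\<close> Qroot]) (simp_all add: zero)
    then show "summable (\<lambda>m. \<bar>u m\<bar>)" by simp
    \<comment> \<open>As \<open>u\<close> is real and Q is monic, taking real parts of the complex
      recurrence gives a real one, still with leading coefficient 1.\<close>
    show "(\<Sum>i<degree Q. Re (coeff Q i) * u (n + i)) + u (n + degree Q) = 0" for n
      using arg_cong[OF zero[of n], of Re] lc
      by (simp add: shift_act_def lessThan_Suc_atMost[symmetric])
    fix m :: "nat \<Rightarrow> int"
    show "(\<Sum>i\<le>degree Q. of_int (m i) * \<beta> ^ i) = 0 \<longrightarrow> (\<forall>i\<le>degree Q. m i = 0)"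
    proof
      assume zero_sum: "(\<Sum>i\<le>degree Q. of_int (m i) * \<beta> ^ i) = 0"
      define r where "r = (\<Sum>i\<le>degree Q. monom (m i) i)"
      have cr: "coeff r i = (if i \<le> degree Q then m i else 0)" for i
        by (simp add: r_def coeff_sum)
      have dr: "degree r \<le> degree Q"
        by (rule degree_le) (simp add: cr)
      have "poly (map_poly of_int r) \<beta> = (\<Sum>i\<le>degree Q. of_int (m i) * \<beta> ^ i)"
        unfolding poly_altdef
        by (rule sum.mono_neutral_cong_left) (use dr cr in \<open>auto simp: degree_map_poly coeff_map_poly cr intro!: le_degree\<close>)
      then have "r = 0" using min[OF dr] zero_sum by simp
      then show "\<forall>i\<le>degree Q. m i = 0" using cr by (metis coeff_0)
    qed
  qed
qed

section \<open>Stationary digit measures\<close>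

definition cylinder :: "int list \<Rightarrow> (nat \<Rightarrow> int) set" where
  "cylinder ws = {x. \<forall>i<length ws. x i = ws ! i}"

lemma cylinder_Cons: "x \<in> cylinder (a # ws) \<longleftrightarrow> x 0 = a \<and> (\<lambda>i. x (Suc i)) \<in> cylinder ws"
  by (simp add: cylinder_def All_less_Suc2)

lemma space_seq_space [simp]: "space seq_space = UNIV"
  by (simp add: seq_space_def space_PiM)

lemma measurable_digit: "(\<lambda>x. x i) \<in> measurable seq_space (count_space UNIV)"
  unfolding seq_space_def by (rule measurable_component_singleton) simp

lemma cylinder_measurable: "cylinder ws \<in> sets seq_space"
proof -
  note measurable_digit[measurable]
  have "{x \<in> space seq_space. \<forall>i<length ws. x i = ws ! i} \<in> sets seq_space"
    by measurable
  then show ?thesis by (simp add: cylinder_def)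
qed

lemma cylinder_Int: "cylinder ws \<inter> cylinder vs = {} \<or> cylinder ws \<inter> cylinder vs \<in> range cylinder"
proof (induction "length ws" "length vs" arbitrary: ws vs rule: linorder_wlog)
  case le
  show ?case
  proof (cases "\<forall>i<length ws. ws ! i = vs ! i")
    case True
    then have "cylinder ws \<inter> cylinder vs = cylinder vs"
      using le by (auto simp: cylinder_def)
    then show ?thesis by auto
  next
    case False
    then show ?thesis using le by (auto simp: cylinder_def)
  qed
next
  case sym
  then show ?case by (simp add: Int_commute)
qed

text \<open>A one-digit event is the union of the cylinders over the words of length i + 1 that end
  in B. The union is countable because there are only countably many integer words.\<close>

lemma sets_seq_space: "sets seq_space = sigma_sets UNIV (insert {} (range cylinder))"
proof
  show "sigma_sets UNIV (insert {} (range cylinder)) \<subseteq> sets seq_space"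
    using sets.sigma_sets_subset[of "insert {} (range cylinder)" seq_space] cylinder_measurable by auto
  interpret S: sigma_algebra UNIV "sigma_sets UNIV (insert {} (range cylinder))"
    by (rule sigma_algebra_sigma_sets) simp
  have "{x. x i \<in> B} \<in> sigma_sets UNIV (insert {} (range cylinder))" for i :: nat and B :: "int set"
  proof -
    have "{x. x i \<in> B} = (\<Union>ws\<in>{ws. length ws = Suc i \<and> last ws \<in> B}. cylinder ws)"
    proof (intro set_eqI iffI)
      fix x :: "nat \<Rightarrow> int" assume "x \<in> {x. x i \<in> B}"
      then have "x \<in> cylinder (map x [0..<Suc i])" "last (map x [0..<Suc i]) \<in> B"
        by (auto simp: cylinder_def simp del: upt_Suc) (simp add: last_map)
      then show "x \<in> (\<Union>ws\<in>{ws. length ws = Suc i \<and> last ws \<in> B}. cylinder ws)"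
        by (intro UN_I[of "map x [0..<Suc i]"]) simp_all
    next
      fix x assume "x \<in> (\<Union>ws\<in>{ws. length ws = Suc i \<and> last ws \<in> B}. cylinder ws)"
      then obtain ws where "length ws = Suc i" "last ws \<in> B" "x \<in> cylinder ws" by auto
      then show "x \<in> {x. x i \<in> B}"
        by (cases "ws = []") (auto simp: cylinder_def last_conv_nth)
    qed
    also have "\<dots> \<in> sigma_sets UNIV (insert {} (range cylinder))"
      by (rule S.countable_UN'[OF countableI_type]) auto
    finally show ?thesis .
  qed
  then have "{{f \<in> UNIV \<rightarrow>\<^sub>E space (count_space UNIV). f i \<in> B} | (i :: nat) (B :: int set). i \<in> UNIV \<and> B \<in> sets (count_space UNIV)}
      \<subseteq> sigma_sets UNIV (insert {} (range cylinder))"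
    by auto
  from sigma_sets_mono[OF this] show "sets seq_space \<subseteq> sigma_sets UNIV (insert {} (range cylinder))"
    unfolding seq_space_def sets_PiM_single by simp
qed

text \<open>The labelled graph is forgotten here; only the cylinder masses \<open>W\<close> remain.
  The sum in \<open>W_stationary\<close> runs over the letter put in front, so it expresses
  invariance under the shift, not the consistency of cylinder masses, which would append a letter at
  the end.\<close>

locale stationary_digits = prob_space \<mu> for \<mu> :: "(nat \<Rightarrow> int) measure" +
  fixes A :: "int set" and W :: "int list \<Rightarrow> real"
  assumes sets_\<mu>: "sets \<mu> = sets seq_space"
    and finite_A: "finite A"
    and W_nonneg: "W ws \<ge> 0"
    and emeasure_cylinder: "emeasure \<mu> (cylinder ws) = ennreal (W ws)"
    and W_stationary: "(\<Sum>a\<in>A. W (a # ws)) = W ws"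
begin

lemma space_\<mu> [simp]: "space \<mu> = UNIV"
  using sets_eq_imp_space_eq[OF sets_\<mu>] by simp

lemma digit_measurable [measurable]: "(\<lambda>x. x i) \<in> measurable \<mu> (count_space UNIV)"
  using measurable_digit measurable_cong_sets[OF sets_\<mu> refl] by blast

lemma cylinder_in_sets [measurable]: "cylinder ws \<in> sets \<mu>"
  using cylinder_measurable sets_\<mu> by simp

lemma emeasure_UN_Cons: "emeasure \<mu> (\<Union>a\<in>A. cylinder (a # ws)) = ennreal (W ws)"
proof -
  have "disjoint_family_on (\<lambda>a. cylinder (a # ws)) A"
    by (auto simp: disjoint_family_on_def cylinder_def)
  then have "emeasure \<mu> (\<Union>a\<in>A. cylinder (a # ws)) = (\<Sum>a\<in>A. emeasure \<mu> (cylinder (a # ws)))"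
    using finite_A by (intro sum_emeasure[symmetric]) auto
  also have "\<dots> = ennreal (\<Sum>a\<in>A. W (a # ws))"
    by (simp add: emeasure_cylinder W_nonneg)
  finally show ?thesis by (simp add: W_stationary)
qed

text \<open>The measure lives on all integer sequences. That its digits lie in \<open>A\<close>
  follows from stationarity at the empty word, whose cylinder is the whole space.\<close>

lemma AE_digit_0: "AE x in \<mu>. x 0 \<in> A"
proof -
  have "cylinder [] = UNIV" by (simp add: cylinder_def)
  then have "emeasure \<mu> (\<Union>a\<in>A. cylinder [a]) = 1"
    using emeasure_UN_Cons[of "[]"] emeasure_cylinder[of "[]"] emeasure_space_1 by simp
  moreover have "(\<Union>a\<in>A. cylinder [a]) = {x. x 0 \<in> A}"
    by (auto simp: cylinder_def)
  ultimately have "prob {x. x 0 \<in> A} = 1"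
    by (simp add: measure_def)
  moreover have "{x \<in> space \<mu>. x 0 \<in> A} \<in> sets \<mu>" by measurable
  ultimately show ?thesis
    by (subst (asm) prob_eq_1) auto
qed

lemma shift_measurable [measurable]: "(\<lambda>x i. x (i + k)) \<in> measurable \<mu> seq_space"
  unfolding seq_space_def by (rule measurable_PiM_single') auto

text \<open>Cylinders with the empty set form an intersection-stable generator, so they suffice. Up
  to a null set, the preimage of a cylinder is the disjoint union of the cylinders with one letter
  of \<open>A\<close> prepended.\<close>

lemma distr_shift: "distr \<mu> seq_space (\<lambda>x i. x (Suc i)) = \<mu>"
proof (rule sym, rule measure_eqI_generator_eq)
  have [measurable]: "(\<lambda>x i. x (Suc i)) \<in> measurable \<mu> seq_space"
    using shift_measurable[of 1] by simp
  show "Int_stable (insert {} (range cylinder))"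
    using cylinder_Int by (auto simp: Int_stable_def)
  show "insert {} (range cylinder) \<subseteq> Pow UNIV" by simp
  fix X assume "X \<in> insert {} (range cylinder)"
  then consider "X = {}" | ws where "X = cylinder ws" by auto
  then show "emeasure \<mu> X = emeasure (distr \<mu> seq_space (\<lambda>x i. x (Suc i))) X"
  proof cases
    case 2
    have "emeasure (distr \<mu> seq_space (\<lambda>x i. x (Suc i))) X = emeasure \<mu> ((\<lambda>x i. x (Suc i)) -` cylinder ws \<inter> space \<mu>)"
      unfolding 2 using cylinder_measurable by (intro emeasure_distr) auto
    also have "\<dots> = emeasure \<mu> (\<Union>a\<in>A. cylinder (a # ws))"
    proof (rule emeasure_eq_AE)
      show "AE x in \<mu>. (x \<in> (\<lambda>x i. x (Suc i)) -` cylinder ws \<inter> space \<mu>) = (x \<in> (\<Union>a\<in>A. cylinder (a # ws)))"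
        using AE_digit_0 by eventually_elim (auto simp: cylinder_Cons)
      show "(\<lambda>x i. x (Suc i)) -` cylinder ws \<inter> space \<mu> \<in> sets \<mu>"
        by (rule measurable_sets[OF _ cylinder_measurable]) measurable
    qed (use finite_A in auto)
    finally show ?thesis by (simp add: emeasure_UN_Cons emeasure_cylinder 2)
  qed simp
next
  show "range (\<lambda>i::nat. cylinder []) \<subseteq> insert {} (range cylinder)" by auto
  show "(\<Union>i::nat. cylinder []) = UNIV" by (simp add: cylinder_def)
qed (auto simp: sets_\<mu> sets_seq_space emeasure_eq_measure)

lemma distr_shift_funpow: "distr \<mu> seq_space (\<lambda>x i. x (i + k)) = \<mu>"
proof (induction k)
  case 0
  show ?case using sets_\<mu> by (simp add: distr_id2)
next
  case (Suc k)
  have m: "(\<lambda>x i. x (i + k)) \<in> measurable \<mu> seq_space" for k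
    by (rule shift_measurable)
  have "distr (distr \<mu> seq_space (\<lambda>x i. x (i + 1))) seq_space (\<lambda>x i. x (i + k)) =
     distr \<mu> seq_space ((\<lambda>x i. x (i + k)) \<circ> (\<lambda>x i. x (i + 1)))"
    by (rule distr_distr) (use m[of 1] m[of k] sets_\<mu> measurable_cong_sets in \<open>auto cong: measurable_cong_sets\<close>)
  then show ?case
    using Suc distr_shift by (simp add: o_def)
qed

lemma AE_shift:
  assumes "AE x in \<mu>. P x" "{x \<in> space seq_space. P x} \<in> sets seq_space"
  shows "AE x in \<mu>. P (\<lambda>i. x (i + k))"
proof -
  have "AE x in distr \<mu> seq_space (\<lambda>x i. x (i + k)). P x"
    using assms(1) by (subst distr_shift_funpow)
  then show ?thesis
    by (subst (asm) AE_distr_iff) (use assms(2) in auto)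
qed

lemma AE_digits: "AE x in \<mu>. \<forall>i. x i \<in> A"
proof -
  have "AE x in \<mu>. x k \<in> A" for k
    using AE_shift[OF AE_digit_0, of k] measurable_sets[OF measurable_digit[of 0], of A]
    by (simp add: vimage_def)
  then show ?thesis by (simp add: AE_all_countable)
qed

end

section \<open>The Riemann-Lebesgue lemma\<close>

lemma borel_measurable_character: "(\<lambda>x. cis (- (2 * pi * x * r))) \<in> borel_measurable borel"
  by (intro borel_measurable_continuous_onI continuous_intros)

lemma integrable_mult_character:
  assumes "integrable lborel (g :: real \<Rightarrow> complex)"
  shows "integrable lborel (\<lambda>x. g x * cis (- (2 * pi * x * r)))"
  by (rule Bochner_Integration.integrable_bound[OF assms])
    (use assms borel_measurable_character[of r] in \<open>auto simp: norm_mult intro!: borel_measurable_times\<close>)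

lemma integrable_complex_indicator:
  assumes "A \<in> sets lborel" "emeasure lborel A < \<infinity>"
  shows "integrable lborel (indicator A :: real \<Rightarrow> complex)"
proof -
  have "integrable lborel (\<lambda>x. indicat_real A x *\<^sub>R (1 :: complex))"
    using assms by (intro integrable_scaleR_left integrable_real_indicator) auto
  then show ?thesis
    by (rule Bochner_Integration.integrable_cong[THEN iffD1, rotated 2]) (auto simp: indicator_def)
qed

text \<open>The explicit antiderivative of the character bounds the integral by 1 / (pi |t k|).
  Half-open intervals are taken because they are stable under intersection and generate the Borel
  sets.\<close>

lemma riemann_lebesgue_interval:
  fixes t :: "nat \<Rightarrow> real"
  assumes t: "filterlim (\<lambda>k. \<bar>t k\<bar>) at_top sequentially"
  shows "(\<lambda>k. \<integral>x. indicator {a<..b} x *\<^sub>R cis (- (2 * pi * x * t k)) \<partial>lborel) \<longlonglongrightarrow> 0"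
proof (cases "a \<le> b")
  case True
  let ?I = "\<lambda>k. \<integral>x. indicator {a<..b} x *\<^sub>R cis (- (2 * pi * x * t k)) \<partial>lborel"
  have bound: "norm (?I k) \<le> inverse \<bar>t k\<bar>" if "t k \<noteq> 0" for k
  proof -
    define w where "w = - (2 * pi * t k)"
    have w: "w \<noteq> 0" using that by (simp add: w_def)
    have eq: "(- \<i> / w) * (z * (\<i> * w)) = z" for z
    proof -
      have "(- \<i> / w) * (z * (\<i> * w)) = - (\<i> * \<i>) * z * (w / w)" by (simp add: algebra_simps)
      then show ?thesis using w by (simp only: i_squared) simp
    qed
    have "?I k = (\<integral>x. indicator {a..b} x *\<^sub>R cis (w * x) \<partial>lborel)"
    proof (rule integral_cong_AE)
      show "AE x in lborel. indicator {a<..b} x *\<^sub>R cis (- (2 * pi * x * t k)) = indicator {a..b} x *\<^sub>R cis (w * x)"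
        using AE_lborel_singleton[of a]
        by eventually_elim (auto simp: w_def algebra_simps split: split_indicator)
      have "cis (w * x) = cis (- (2 * pi * x * t k))" for x by (simp add: w_def algebra_simps)
      then show "(\<lambda>x. indicator {a..b} x *\<^sub>R cis (w * x)) \<in> borel_measurable lborel"
        "(\<lambda>x. indicator {a<..b} x *\<^sub>R cis (- (2 * pi * x * t k))) \<in> borel_measurable lborel"
        using borel_measurable_character[of "t k"] by (auto intro!: borel_measurable_scaleR)
    qed
    also have "\<dots> = (- \<i> / w) * cis (w * b) - (- \<i> / w) * cis (w * a)"
    proof (rule integral_FTC_Icc[OF True])
      show "continuous_on {a..b} (\<lambda>x. cis (w * x))"
        unfolding cis_conv_exp by (intro continuous_intros)
      fix x :: real
      have "((\<lambda>x. (- \<i> / w) * exp (\<i> * (w * x))) has_vector_derivative ((- \<i> / w) * (exp (\<i> * (w * x)) * (\<i> * w)))) (at x within {a..b})"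
      proof (rule has_vector_derivative_mult_right)
        have "((\<lambda>z. exp (\<i> * (of_real w * z))) has_field_derivative exp (\<i> * (of_real w * of_real x)) * (\<i> * of_real w)) (at (of_real x))"
          by (auto intro!: derivative_eq_intros)
        from has_vector_derivative_real_field[OF this]
        show "((\<lambda>x. exp (\<i> * (w * x))) has_vector_derivative (exp (\<i> * (w * x)) * (\<i> * w))) (at x within {a..b})"
          by simp
      qed
      then show "((\<lambda>x. (- \<i> / w) * cis (w * x)) has_vector_derivative cis (w * x)) (at x within {a..b})"
        using eq[of "exp (\<i> * (w * x))"] by (simp only: cis_conv_exp)
    qed
    also have "norm \<dots> \<le> norm ((- \<i> / w) * cis (w * b)) + norm ((- \<i> / w) * cis (w * a))"
      by (rule norm_triangle_ineq4)
    also have "\<dots> = 2 / \<bar>w\<bar>"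
      by (simp add: norm_mult norm_divide)
    also have "\<dots> \<le> inverse \<bar>t k\<bar>"
      using that pi_ge_two by (simp add: w_def abs_mult field_simps)
    finally show ?thesis .
  qed
  have "eventually (\<lambda>k. \<bar>t k\<bar> > 0) sequentially"
    using t unfolding filterlim_at_top_dense by blast
  then have "eventually (\<lambda>k. norm (?I k) \<le> inverse \<bar>t k\<bar>) sequentially"
    by eventually_elim (rule bound, simp)
  then show ?thesis
    by (rule Lim_null_comparison[OF _ tendsto_inverse_0_at_top[OF t]])
qed simp

lemma tendsto_0_via_approx:
  fixes F :: "nat \<Rightarrow> 'a::real_normed_vector"
  assumes "\<And>e. e > 0 \<Longrightarrow> \<exists>G. G \<longlonglongrightarrow> 0 \<and> (\<forall>k. norm (F k - G k) \<le> e)"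
  shows "F \<longlonglongrightarrow> 0"
proof (rule tendstoI)
  fix e :: real assume "e > 0"
  then obtain G where G: "G \<longlonglongrightarrow> 0" "\<And>k. norm (F k - G k) \<le> e / 2"
    using assms[of "e / 2"] by auto
  have "\<forall>\<^sub>F k in sequentially. norm (G k) < e / 2"
    using tendstoD[OF G(1), of "e / 2"] \<open>e > 0\<close> by simp
  then show "\<forall>\<^sub>F k in sequentially. dist (F k) 0 < e"
  proof eventually_elim
    case (elim k)
    have "norm (F k) \<le> norm (F k - G k) + norm (G k)"
      using norm_triangle_ineq[of "F k - G k" "G k"] by simp
    with elim G(2)[of k] show ?case by simp
  qed
qed

text \<open>Characters have modulus 1, so the error is at most the L1 distance to the approximant,
  uniformly in k.\<close>

lemma fourier_L1_approx:
  fixes f :: "real \<Rightarrow> complex" and s :: "nat \<Rightarrow> real \<Rightarrow> complex"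
  assumes s: "\<And>i. integrable lborel (s i)" and f: "integrable lborel f"
    and RL: "\<And>i. (\<lambda>k. \<integral>x. s i x * cis (- (2 * pi * x * t k)) \<partial>lborel) \<longlonglongrightarrow> 0"
    and lim: "(\<lambda>i. \<integral>x. norm (f x - s i x) \<partial>lborel) \<longlonglongrightarrow> 0"
  shows "(\<lambda>k. \<integral>x. f x * cis (- (2 * pi * x * t k)) \<partial>lborel) \<longlonglongrightarrow> 0"
proof (rule tendsto_0_via_approx)
  fix e :: real assume "e > 0"
  then have "\<forall>\<^sub>F i in sequentially. norm (\<integral>x. norm (f x - s i x) \<partial>lborel) < e"
    using tendstoD[OF lim] by simp
  then obtain i where i: "(\<integral>x. norm (f x - s i x) \<partial>lborel) < e"
    by (auto dest: eventually_happens)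
  show "\<exists>G. G \<longlonglongrightarrow> 0 \<and> (\<forall>k. norm ((\<integral>x. f x * cis (- (2 * pi * x * t k)) \<partial>lborel) - G k) \<le> e)"
  proof (intro exI conjI allI)
    show "(\<lambda>k. \<integral>x. s i x * cis (- (2 * pi * x * t k)) \<partial>lborel) \<longlonglongrightarrow> 0" by (rule RL)
    fix k
    have "(\<integral>x. f x * cis (- (2 * pi * x * t k)) \<partial>lborel) - (\<integral>x. s i x * cis (- (2 * pi * x * t k)) \<partial>lborel)
       = (\<integral>x. (f x - s i x) * cis (- (2 * pi * x * t k)) \<partial>lborel)"
      by (simp only: left_diff_distrib Bochner_Integration.integral_diff integrable_mult_character s f)
    also have "norm \<dots> \<le> (\<integral>x. norm ((f x - s i x) * cis (- (2 * pi * x * t k))) \<partial>lborel)"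
      by (rule integral_norm_bound)
    also have "\<dots> \<le> e" using i by (simp add: norm_mult)
    finally show "norm ((\<integral>x. f x * cis (- (2 * pi * x * t k)) \<partial>lborel) - (\<integral>x. s i x * cis (- (2 * pi * x * t k)) \<partial>lborel)) \<le> e" .
  qed
qed

text \<open>A Dynkin-system argument starting from half-open intervals. The cut with
  \<open>{a<..b}\<close> keeps complements integrable, and disjoint unions are L1 limits of their
  finite parts.\<close>

lemma riemann_lebesgue_set:
  fixes t :: "nat \<Rightarrow> real"
  assumes t: "filterlim (\<lambda>k. \<bar>t k\<bar>) at_top sequentially"
    and A: "A \<in> sets borel"
  shows "(\<lambda>k. \<integral>x. indicator (A \<inter> {a<..b}) x * cis (- (2 * pi * x * t k)) \<partial>lborel) \<longlonglongrightarrow> 0"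
proof -
  have scaleR: "indicat_real S x *\<^sub>R z = indicator S x * z" for S :: "real set" and x and z :: complex
    by (simp add: indicator_def)
  let ?G = "range (\<lambda>(a, b). {a<..b::real})"
  let ?c = "\<lambda>k x. cis (- (2 * pi * x * t k))"
  have fin: "emeasure lborel (B \<inter> {a<..b}) < \<infinity>" if "B \<in> sets borel" for B
  proof -
    have "emeasure lborel (B \<inter> {a<..b}) \<le> emeasure lborel {a..b}"
      using that by (intro emeasure_mono) auto
    also have "\<dots> < \<infinity>"
      by (simp add: emeasure_lborel_Icc_eq)
    finally show ?thesis .
  qed
  have int: "integrable lborel (indicator (B \<inter> {a<..b}) :: real \<Rightarrow> complex)" if "B \<in> sets borel" for B
    using that fin[OF that] by (intro integrable_complex_indicator) auto
  have intc: "integrable lborel (\<lambda>x. indicator (B \<inter> {a<..b}) x * ?c k x)" if "B \<in> sets borel" for B k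
    by (rule integrable_mult_character[OF int[OF that]])
  have borel: "sigma_sets UNIV ?G = sets borel"
    by (subst borel_sigma_sets_Ioc) simp
  have stable: "Int_stable ?G"
  proof (rule Int_stableI)
    fix A B assume "A \<in> ?G" "B \<in> ?G"
    then obtain p q r s where "A = {p<..q}" "B = {r<..s}" by auto
    then have "A \<inter> B = {max p r<..min q s}" by auto
    then show "A \<inter> B \<in> ?G" by auto
  qed
  have "A \<in> sigma_sets UNIV ?G" using A borel by simp
  from stable subset_UNIV[of ?G, folded Pow_UNIV] this show ?thesis
  proof (induction rule: sigma_sets_induct_disjoint)
    case (basic A)
    then obtain p q where "A = {p<..q}" by auto
    then have "A \<inter> {a<..b} = {max p a<..min q b}" by auto
    then show ?case
      using riemann_lebesgue_interval[OF t, of "max p a" "min q b"]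
      by (simp add: scaleR)
  next
    case (compl A)
    then have A: "A \<in> sets borel" by (simp add: borel)
    have "(\<integral>x. indicator ((UNIV - A) \<inter> {a<..b}) x * ?c k x \<partial>lborel)
        = (\<integral>x. indicator (UNIV \<inter> {a<..b}) x * ?c k x \<partial>lborel) - (\<integral>x. indicator (A \<inter> {a<..b}) x * ?c k x \<partial>lborel)" for k
      by (subst Bochner_Integration.integral_diff[symmetric], rule intc, simp, rule intc, rule A)
        (auto intro!: Bochner_Integration.integral_cong simp: indicator_def)
    moreover have "(\<lambda>k. \<integral>x. indicator (UNIV \<inter> {a<..b}) x * ?c k x \<partial>lborel) \<longlonglongrightarrow> 0"
      using riemann_lebesgue_interval[OF t, of a b]
      by (simp add: scaleR)
    ultimately show ?case
      using tendsto_diff[OF _ compl(2)] by fastforce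
  next
    case (union A)
    then have A: "A i \<in> sets borel" for i by (auto simp: borel)
    let ?s = "\<lambda>i x. indicator ((\<Union>j<i. A j) \<inter> {a<..b}) x :: complex"
    show ?case
    proof (rule fourier_L1_approx[where s = ?s])
      show "integrable lborel (?s i)" for i using A by (intro int) auto
      show U: "integrable lborel (indicator ((\<Union>i. A i) \<inter> {a<..b}) :: real \<Rightarrow> complex)"
        using A by (intro int) auto
      show "(\<lambda>k. \<integral>x. ?s i x * ?c k x \<partial>lborel) \<longlonglongrightarrow> 0" for i
      proof (induction i)
        case (Suc i)
        have "(\<integral>x. ?s (Suc i) x * ?c k x \<partial>lborel)
            = (\<integral>x. ?s i x * ?c k x \<partial>lborel) + (\<integral>x. indicator (A i \<inter> {a<..b}) x * ?c k x \<partial>lborel)" for k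
        proof (subst Bochner_Integration.integral_add[symmetric])
          have "x \<notin> A j" if "x \<in> A i" "j < i" for x j
            using disjoint_family_onD[OF \<open>disjoint_family A\<close>, of i j] that by auto
          then show "(\<integral>x. ?s (Suc i) x * ?c k x \<partial>lborel) = (\<integral>x. ?s i x * ?c k x + indicator (A i \<inter> {a<..b}) x * ?c k x \<partial>lborel)"
            by (intro Bochner_Integration.integral_cong) (auto simp: indicator_def less_Suc_eq)
        qed (use A in \<open>auto intro!: intc\<close>)
        then show ?case
          using tendsto_add[OF Suc union(3)[of i]] by simp
      qed simp
      show "(\<lambda>i. \<integral>x. norm (indicator ((\<Union>i. A i) \<inter> {a<..b}) x - ?s i x) \<partial>lborel) \<longlonglongrightarrow> 0"
      proof -
        have "(\<lambda>i. \<integral>x. norm (indicator ((\<Union>i. A i) \<inter> {a<..b}) x - ?s i x) \<partial>lborel) \<longlonglongrightarrow> (\<integral>x. 0 \<partial>(lborel :: real measure))"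
        proof (rule integral_dominated_convergence)
          show "integrable lborel (\<lambda>x. norm (indicator ((\<Union>i. A i) \<inter> {a<..b}) x :: complex))"
            using U by (rule integrable_norm)
          show "AE x in lborel. (\<lambda>i. norm (indicator ((\<Union>i. A i) \<inter> {a<..b}) x - ?s i x)) \<longlonglongrightarrow> 0"
          proof (rule AE_I2)
            fix x
            have "\<forall>\<^sub>F i in sequentially. norm (indicator ((\<Union>i. A i) \<inter> {a<..b}) x - ?s i x) = 0"
            proof (cases "x \<in> (\<Union>i. A i)")
              case True
              then obtain j where "x \<in> A j" by auto
              then have "\<forall>i\<ge>Suc j. norm (indicator ((\<Union>i. A i) \<inter> {a<..b}) x - ?s i x) = 0"
                by (auto simp: indicator_def)
              then show ?thesis unfolding eventually_sequentially by blast
            next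
              case False
              then show ?thesis by (intro always_eventually) (auto simp: indicator_def)
            qed
            then show "(\<lambda>i. norm (indicator ((\<Union>i. A i) \<inter> {a<..b}) x - ?s i x)) \<longlonglongrightarrow> 0"
              by (rule tendsto_eventually)
          qed
        qed (use A in \<open>auto simp: indicator_def\<close>)
        then show ?thesis by simp
      qed
    qed
  qed auto
qed

proposition riemann_lebesgue:
  fixes f :: "real \<Rightarrow> complex" and t :: "nat \<Rightarrow> real"
  assumes f: "integrable lborel f" and t: "filterlim (\<lambda>k. \<bar>t k\<bar>) at_top sequentially"
  shows "(\<lambda>k. \<integral>x. f x * cis (- (2 * pi * x * t k)) \<partial>lborel) \<longlonglongrightarrow> 0"
  using f
proof (induction rule: integrable_induct)
  case (base A c)
  then have A: "A \<in> sets borel" by simp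
  have IA: "integrable lborel (indicator A :: real \<Rightarrow> complex)"
    using base by (intro integrable_complex_indicator)
  let ?s = "\<lambda>i x. indicator (A \<inter> {- real i<..real i}) x :: complex"
  have "(\<lambda>k. \<integral>x. indicator A x * cis (- (2 * pi * x * t k)) \<partial>lborel) \<longlonglongrightarrow> 0"
  proof (rule fourier_L1_approx[where s = ?s, OF _ IA])
    show "integrable lborel (?s i)" for i
      by (rule Bochner_Integration.integrable_bound[OF IA]) (use A in \<open>auto simp: indicator_def\<close>)
    show "(\<lambda>k. \<integral>x. ?s i x * cis (- (2 * pi * x * t k)) \<partial>lborel) \<longlonglongrightarrow> 0" for i
      by (rule riemann_lebesgue_set[OF t A])
    have "(\<lambda>i. \<integral>x. norm (indicator A x - ?s i x) \<partial>lborel) \<longlonglongrightarrow> (\<integral>x. 0 \<partial>(lborel :: real measure))"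
    proof (rule integral_dominated_convergence)
      show "integrable lborel (\<lambda>x. norm (indicator A x :: complex))"
        using IA by (rule integrable_norm)
      show "AE x in lborel. (\<lambda>i. norm (indicator A x - ?s i x)) \<longlonglongrightarrow> 0"
      proof (rule AE_I2)
        fix x :: real
        obtain j where j: "\<bar>x\<bar> < real j" using reals_Archimedean2 by blast
        then have "\<forall>i\<ge>j. norm (indicator A x - ?s i x) = 0"
          by (auto simp: indicator_def)
        then have "\<forall>\<^sub>F i in sequentially. norm (indicator A x - ?s i x) = 0"
          unfolding eventually_sequentially by blast
        then show "(\<lambda>i. norm (indicator A x - ?s i x)) \<longlonglongrightarrow> 0"
          by (rule tendsto_eventually)
      qed
    qed (use A in \<open>auto simp: indicator_def\<close>)
    then show "(\<lambda>i. \<integral>x. norm (indicator A x - ?s i x) \<partial>lborel) \<longlonglongrightarrow> 0" by simp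
  qed
  from tendsto_mult_right_zero[OF this, of c] show ?case
    by (simp add: scaleR_conv_of_real of_real_indicator algebra_simps flip: integral_mult_right_zero)
next
  case (add f g)
  from tendsto_add[OF add(3,4)] show ?case
    by (simp only: distrib_right Bochner_Integration.integral_add integrable_mult_character add(1,2) add_0)
next
  case (lim f s)
  have "(\<lambda>i. \<integral>x. norm (f x - s i x) \<partial>lborel) \<longlonglongrightarrow> (\<integral>x. 0 \<partial>(lborel :: real measure))"
  proof (rule integral_dominated_convergence)
    \<comment> \<open>The approximants supplied by the induction rule are bounded by 2 * norm (f x),
      whence the factor 3.\<close>
    show "integrable lborel (\<lambda>x. 3 * norm (f x))" using lim.hyps(4) by simp
    show "AE x in lborel. (\<lambda>i. norm (f x - s i x)) \<longlonglongrightarrow> 0"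
    proof (rule AE_I2)
      fix x
      show "(\<lambda>i. norm (f x - s i x)) \<longlonglongrightarrow> 0"
        using tendsto_norm[OF tendsto_diff[OF tendsto_const[of "f x"] lim.hyps(2)[of x]]] by simp
    qed
    show "AE x in lborel. norm (norm (f x - s i x)) \<le> 3 * norm (f x)" for i
    proof (rule AE_I2)
      fix x
      show "norm (norm (f x - s i x)) \<le> 3 * norm (f x)"
        using norm_triangle_ineq4[of "f x" "s i x"] lim.hyps(3)[of x i] by simp
    qed
  qed (use lim.hyps in auto)
  then show ?case
    by (intro fourier_L1_approx[OF lim.hyps(1,4) lim.IH]) simp
qed

lemma fourier_tendsto_0_if_absolutely_continuous:
  fixes \<nu> :: "real measure" and t :: "nat \<Rightarrow> real"
  assumes \<nu>: "prob_space \<nu>" "sets \<nu> = sets lborel" and ac: "absolutely_continuous lborel \<nu>"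
    and t: "filterlim (\<lambda>k. \<bar>t k\<bar>) at_top sequentially"
  shows "(\<lambda>k. fourier \<nu> (t k)) \<longlonglongrightarrow> 0"
proof -
  interpret \<nu>: prob_space \<nu> by fact
  obtain f' where f': "f' \<in> borel_measurable lborel" "density lborel f' = \<nu>"
    using sigma_finite_measure.Radon_Nikodym[OF sigma_finite_lborel ac \<nu>(2)] by blast
  have "(\<integral>\<^sup>+x. f' x \<partial>lborel) = emeasure \<nu> UNIV"
    using f' by (auto simp: emeasure_density)
  then have nn: "(\<integral>\<^sup>+x. f' x \<partial>lborel) = 1"
    using \<nu>.emeasure_space_1 sets_eq_imp_space_eq[OF \<nu>(2)] by simp
  then have fin: "AE x in lborel. f' x \<noteq> \<infinity>"
    using f' by (intro nn_integral_PInf_AE) auto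
  define f where "f x = enn2real (f' x)" for x
  have [measurable]: "f \<in> borel_measurable borel"
    using f'(1) unfolding f_def by simp
  have f_eq: "AE x in lborel. f' x = ennreal (f x)"
    using fin by eventually_elim (simp add: f_def less_top)
  have dens: "\<nu> = density lborel (\<lambda>x. ennreal (f x))"
    unfolding f'(2)[symmetric] using f'(1) f_eq by (intro density_cong) auto
  have fint: "integrable lborel f"
    using nn f_eq by (intro integrableI_nn_integral_finite[where x = 1])
      (auto simp: f_def cong: nn_integral_cong_AE)
  have "fourier \<nu> r = (\<integral>x. complex_of_real (f x) * cis (- (2 * pi * x * r)) \<partial>lborel)" for r
    unfolding fourier_def dens
    by (subst integral_density) (use borel_measurable_character[of r] in \<open>auto simp: f_def scaleR_conv_of_real\<close>)
  moreover have "integrable lborel (\<lambda>x. complex_of_real (f x))"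
    using fint by simp
  ultimately show ?thesis
    using riemann_lebesgue[OF _ t] by simp
qed

section \<open>Measures dominated by Lebesgue measure on intervals\<close>

text \<open>An open set is covered by countably many compact intervals inside it with disjoint
  interiors. Shared endpoints do no harm: on the \<nu> side countable subadditivity is enough, and
  on the Lebesgue side the lengths are those of the disjoint interiors. The truncation to (-r, r)
  provides the bounded box that the covering argument requires.\<close>

lemma emeasure_le_lborel_open:
  fixes \<nu> :: "real measure"
  assumes sets: "sets \<nu> = sets borel"
    and le: "\<And>a b. a < b \<Longrightarrow> emeasure \<nu> {a..b} \<le> ennreal (C * (b - a))" and "C \<ge> 0"
    and U: "open U"
  shows "emeasure \<nu> U \<le> ennreal C * emeasure lborel U"
proof -
  have *: "emeasure \<nu> (U \<inter> {-r<..<r}) \<le> ennreal C * emeasure lborel U" for r :: real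
  proof (cases "r > 0")
    case True
    have "\<exists>e>0. x \<in> U \<longrightarrow> ball x e \<subseteq> U" for x
      using U open_contains_ball by (cases "x \<in> U") (auto intro: exI[of _ 1])
    then obtain e where e: "\<And>x. e x > 0" "\<And>x. x \<in> U \<Longrightarrow> ball x (e x) \<subseteq> U"
      by metis
    have gauge: "gauge (\<lambda>x. ball x (e x))"
      by (intro gauge_ball_dependent) (auto simp: e)
    have cbox: "U \<inter> {-r<..<r} \<subseteq> cbox (-r) r" and box: "box (-r) r \<noteq> {}"
      using True by auto
    obtain \<D> where "countable \<D>"
      "\<And>K. K \<in> \<D> \<Longrightarrow> interior K \<noteq> {} \<and> (\<exists>c d. K = cbox c d)"
      "pairwise (\<lambda>A B. interior A \<inter> interior B = {}) \<D>"
      "\<And>K. K \<in> \<D> \<Longrightarrow> \<exists>x \<in> U \<inter> {-r<..<r} \<inter> K. K \<subseteq> ball x (e x)"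
      "U \<inter> {-r<..<r} \<subseteq> \<Union>\<D>"
    proof (rule covering_lemma[OF cbox box gauge], goal_cases)
      case (1 \<D>)
      show thesis by (rule that[OF 1(2,4,5,6,8)])
    qed
    note \<D> = this
    have K: "emeasure \<nu> K \<le> ennreal C * emeasure lborel (interior K) \<and> K \<in> sets borel \<and> interior K \<subseteq> U"
      if "K \<in> \<D>" for K
    proof -
      from \<D>(2)[OF that] obtain c d where K: "K = {c..d}" "{c<..<d} \<noteq> {}" by auto
      then have "c < d" by auto
      have "K \<subseteq> U" using \<D>(4)[OF that] e(2) by blast
      then show ?thesis
        using le[OF \<open>c < d\<close>] \<open>C \<ge> 0\<close> \<open>c < d\<close> K interior_subset[of K]
        by (auto simp: ennreal_mult)
    qed
    obtain f :: "real set \<Rightarrow> nat" where f: "inj_on f \<D>"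
      using \<D>(1) by (auto simp: countable_def)
    \<comment> \<open>An enumeration of the cover by the naturals; indices that belong to no
      interval receive the empty set.\<close>
    define J where "J n = \<Union>{K \<in> \<D>. f K = n}" for n
    have J_f: "J (f K) = K" if "K \<in> \<D>" for K
    proof -
      have "{K' \<in> \<D>. f K' = f K} = {K}"
        using f that by (auto simp: inj_on_def)
      then show ?thesis by (simp add: J_def)
    qed
    have J_cases: "J n = {} \<or> J n \<in> \<D> \<and> f (J n) = n" for n
    proof (cases "n \<in> f ` \<D>")
      case True
      then show ?thesis using J_f by auto
    next
      case False
      then have "{K \<in> \<D>. f K = n} = {}" by auto
      then show ?thesis by (simp only: J_def) simp
    qed
    have JK: "emeasure \<nu> (J n) \<le> ennreal C * emeasure lborel (interior (J n))" "J n \<in> sets borel" "interior (J n) \<subseteq> U" for n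
      using J_cases[of n] K[of "J n"] by auto
    have disj: "disjoint_family (\<lambda>n. interior (J n))"
      unfolding disjoint_family_on_def
    proof (intro ballI impI)
      fix m n :: nat assume "m \<noteq> n"
      show "interior (J m) \<inter> interior (J n) = {}"
      proof (cases "J m = {} \<or> J n = {}")
        case False
        then have "J m \<in> \<D>" "J n \<in> \<D>" "J m \<noteq> J n"
          using J_cases[of m] J_cases[of n] \<open>m \<noteq> n\<close> by metis+
        then show ?thesis using pairwiseD[OF \<D>(3)] by blast
      qed auto
    qed
    have "U \<inter> {-r<..<r} \<subseteq> (\<Union>n. J n)"
      using \<D>(5) J_f by blast
    then have "emeasure \<nu> (U \<inter> {-r<..<r}) \<le> emeasure \<nu> (\<Union>n. J n)"
      by (intro emeasure_mono) (use JK sets in auto)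
    also have "\<dots> \<le> (\<Sum>n. emeasure \<nu> (J n))"
      using JK sets by (intro emeasure_subadditive_countably) auto
    also have "\<dots> \<le> (\<Sum>n. ennreal C * emeasure lborel (interior (J n)))"
      by (intro suminf_le JK) auto
    also have "\<dots> = ennreal C * (\<Sum>n. emeasure lborel (interior (J n)))"
      by simp
    also have "(\<Sum>n. emeasure lborel (interior (J n))) = emeasure lborel (\<Union>n. interior (J n))"
      using disj by (intro suminf_emeasure) auto
    also have "ennreal C * \<dots> \<le> ennreal C * emeasure lborel U"
      using JK U by (intro mult_left_mono emeasure_mono) auto
    finally show ?thesis .
  qed simp
  have "(\<lambda>n. emeasure \<nu> (U \<inter> {-real n<..<real n})) \<longlonglongrightarrow> emeasure \<nu> (\<Union>n. U \<inter> {-real n<..<real n})"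
  proof (rule Lim_emeasure_incseq)
    show "incseq (\<lambda>n. U \<inter> {-real n<..<real n})" by (auto simp: incseq_def)
    have "U \<inter> {-real n<..<real n} \<in> sets \<nu>" for n
      unfolding sets using U by (intro borel_open open_Int open_greaterThanLessThan)
    then show "range (\<lambda>n. U \<inter> {-real n<..<real n}) \<subseteq> sets \<nu>" by blast
  qed
  moreover have "(\<Union>n. U \<inter> {-real n<..<real n}) = U"
  proof -
    have "\<exists>n. x \<in> {-real n<..<real n}" for x
    proof -
      obtain n where "\<bar>x\<bar> < real n" using reals_Archimedean2 by blast
      then show ?thesis by (intro exI[of _ n]) auto
    qed
    then show ?thesis by auto
  qed
  ultimately show ?thesis
    using * by (intro LIMSEQ_le_const2[where X = "\<lambda>n. emeasure \<nu> (U \<inter> {-real n<..<real n})"]) auto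
qed

text \<open>By outer regularity, a Lebesgue null set lies in open sets of arbitrarily small length,
  and there the interval bound already controls \<nu>.\<close>

lemma absolutely_continuous_if_le_interval:
  fixes \<nu> :: "real measure"
  assumes sets: "sets \<nu> = sets borel"
    and le: "\<And>a b. a < b \<Longrightarrow> emeasure \<nu> {a..b} \<le> ennreal (C * (b - a))" and C: "C \<ge> 0"
  shows "absolutely_continuous lborel \<nu>"
  unfolding absolutely_continuous_def
proof
  fix N :: "real set" assume N: "N \<in> null_sets lborel"
  have "emeasure \<nu> N \<le> ennreal C * ennreal e" if "e > 0" for e
  proof -
    obtain U where U: "open U" "N \<subseteq> U" "emeasure lborel (U - N) < ennreal e"
      using outer_regular_lborel[of N e] null_setsD2[OF N] \<open>e > 0\<close> unfolding sets_lborel by metis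
    have "emeasure lborel U = emeasure lborel (U - N)"
      using N U by (intro emeasure_Diff_null_set[symmetric]) auto
    then have "emeasure lborel U \<le> ennreal e" using U by simp
    have "emeasure \<nu> N \<le> emeasure \<nu> U"
      using U sets by (intro emeasure_mono) auto
    also have "\<dots> \<le> ennreal C * emeasure lborel U"
      by (rule emeasure_le_lborel_open[OF sets le C U(1)])
    also have "\<dots> \<le> ennreal C * ennreal e"
      by (intro mult_left_mono) (use \<open>emeasure lborel U \<le> ennreal e\<close> in auto)
    finally show ?thesis .
  qed
  then have *: "emeasure \<nu> N \<le> ennreal (C * e)" if "e > 0" for e
    using that C by (simp add: ennreal_mult)
  have "emeasure \<nu> N \<le> 0"
  proof (rule ennreal_le_epsilon)
    fix e :: real assume "e > 0"
    \<comment> \<open>The denominator C + 1 instead of C admits C = 0.\<close>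
    have "emeasure \<nu> N \<le> ennreal (C * (e / (C + 1)))"
      by (rule *) (use \<open>e > 0\<close> C in auto)
    also have "\<dots> \<le> ennreal e"
      using \<open>e > 0\<close> C by (intro ennreal_leI) (simp add: field_simps)
    finally show "emeasure \<nu> N \<le> 0 + ennreal e" by simp
  qed
  then show "N \<in> null_sets \<nu>"
    using N sets by (auto simp: null_sets_def)
qed

section \<open>Expansions modulo integers and the Dirichlet kernel\<close>

lemma summable_digit_series:
  assumes "\<beta> > 1" and "\<And>j. \<bar>real_of_int (x j)\<bar> \<le> B"
  shows "summable (\<lambda>j. real_of_int (x j) / \<beta> ^ Suc j)"
proof (rule summable_comparison_test')
  show "summable (\<lambda>j. B * (1 / \<beta>) ^ Suc j)"
    using assms(1) by (intro summable_mult summable_ignore_initial_segment[of _ 1, simplified] summable_geometric) auto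
  show "norm (real_of_int (x j) / \<beta> ^ Suc j) \<le> B * (1 / \<beta>) ^ Suc j" for j
    using assms(2)[of j] assms(1) by (simp add: power_divide divide_right_mono abs_mult field_simps)
qed

lemma phi_plus_shift:
  assumes "\<beta> > 1" and "\<And>j. \<bar>real_of_int (x j)\<bar> \<le> B"
  shows "\<beta> ^ k * phi_plus \<beta> x = (\<Sum>j<k. of_int (x j) * \<beta> ^ (k - Suc j)) + phi_plus \<beta> (\<lambda>i. x (i + k))"
proof -
  let ?f = "\<lambda>j. real_of_int (x j) / \<beta> ^ Suc j"
  have "\<beta> \<noteq> 0" using assms by auto
  have f: "summable ?f" by (rule summable_digit_series[OF assms])
  have "phi_plus \<beta> x = (\<Sum>n. ?f (n + k)) + sum ?f {..<k}"
    unfolding phi_plus_def by (rule suminf_split_initial_segment[OF f])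
  moreover have "\<beta> ^ k * (\<Sum>n. ?f (n + k)) = phi_plus \<beta> (\<lambda>i. x (i + k))"
    unfolding phi_plus_def suminf_mult[OF summable_ignore_initial_segment[OF f], symmetric]
    using \<open>\<beta> \<noteq> 0\<close> by (intro suminf_cong) (simp add: power_add field_simps)
  moreover have "\<beta> ^ k * sum ?f {..<k} = (\<Sum>j<k. of_int (x j) * \<beta> ^ (k - Suc j))"
    unfolding sum_distrib_left using \<open>\<beta> \<noteq> 0\<close>
    by (intro sum.cong) (auto simp: power_diff Suc_leI field_simps)
  ultimately show ?thesis
    by (simp add: algebra_simps)
qed

text \<open>Here \<open>g m\<close> plays the role of the trace of \<open>\<beta> ^ m\<close>, so \<open>U i\<close> is the sum of the other conjugates
  of \<open>\<beta> ^ i * a\<close>, where \<open>a\<close> is the element of \<open>\<int>[\<beta>]\<close> spelled by the first \<open>k\<close> digits.\<close>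

lemma expansion_mod_integers:
  assumes "\<beta> > 1" and B: "\<And>j. \<bar>real_of_int (x j)\<bar> \<le> B"
    and gu: "\<And>m. real_of_int (g m) = \<beta> ^ m + u m" and su: "summable (\<lambda>m. \<bar>u m\<bar>)"
    and q: "\<And>n. (\<Sum>i<e. q i * u (n + i)) + u (n + e) = 0"
  shows "\<exists>U.
    (\<forall>i. \<beta> ^ (k + i) * phi_plus \<beta> x - (\<beta> ^ i * phi_plus \<beta> (\<lambda>j. x (j + k)) - U i) \<in> \<int>) \<and>
    (\<forall>i. \<bar>U i\<bar> \<le> B * (\<Sum>m. \<bar>u m\<bar>)) \<and> (\<Sum>i<e. q i * U i) + U e = 0"
proof (intro exI conjI allI)
  \<comment> \<open>The error made when each power of \<beta> in the integer part of the expansion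
    is replaced by the nearby integer \<open>g\<close>.\<close>
  define U where "U i = (\<Sum>j<k. of_int (x j) * u (k - Suc j + i))" for i
  show "\<beta> ^ (k + i) * phi_plus \<beta> x - (\<beta> ^ i * phi_plus \<beta> (\<lambda>j. x (j + k)) - U i) \<in> \<int>" for i
  proof -
    have "\<beta> ^ (k + i) * phi_plus \<beta> x - (\<beta> ^ i * phi_plus \<beta> (\<lambda>j. x (j + k)) - U i)
        = \<beta> ^ i * (\<beta> ^ k * phi_plus \<beta> x) - \<beta> ^ i * phi_plus \<beta> (\<lambda>j. x (j + k)) + U i"
      by (simp add: power_add algebra_simps)
    also have "\<dots> = (\<Sum>j<k. \<beta> ^ i * (of_int (x j) * \<beta> ^ (k - Suc j))) + U i"
      unfolding phi_plus_shift[OF assms(1) B, of k] by (simp add: algebra_simps sum_distrib_left)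
    also have "\<dots> = (\<Sum>j<k. of_int (x j) * (\<beta> ^ (k - Suc j + i) + u (k - Suc j + i)))"
      unfolding U_def sum.distrib[symmetric]
      by (intro sum.cong refl) (simp only: power_add distrib_left mult_ac)
    also have "\<dots> = of_int (\<Sum>j<k. x j * g (k - Suc j + i))"
      by (simp add: gu)
    finally show ?thesis by (metis Ints_of_int)
  qed
  have "B \<ge> 0" using B[of 0] by linarith
  show "\<bar>U i\<bar> \<le> B * (\<Sum>m. \<bar>u m\<bar>)" for i
  proof -
    have "\<bar>U i\<bar> \<le> (\<Sum>j<k. \<bar>of_int (x j) * u (k - Suc j + i)\<bar>)"
      unfolding U_def by (rule sum_abs)
    also have "\<dots> \<le> (\<Sum>j<k. B * \<bar>u (k - Suc j + i)\<bar>)"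
      by (intro sum_mono) (use B in \<open>auto simp: abs_mult intro: mult_right_mono\<close>)
    \<comment> \<open>Reversing the order of summation turns the sum into a block of the series of
      |u|, so the bound does not depend on k.\<close>
    also have "\<dots> = B * (\<Sum>j<k. \<bar>u (j + i)\<bar>)"
      using sum.nat_diff_reindex[of "\<lambda>j. \<bar>u (j + i)\<bar>" k]
      by (simp only: sum_distrib_left[symmetric])
    also have "(\<Sum>j<k. \<bar>u (j + i)\<bar>) = (\<Sum>m\<in>{i..<i + k}. \<bar>u m\<bar>)"
      using sum.shift_bounds_nat_ivl[of "\<lambda>m. \<bar>u m\<bar>" 0 i k] by (simp add: lessThan_atLeast0 add.commute)
    also have "B * \<dots> \<le> B * (\<Sum>m. \<bar>u m\<bar>)"
      by (intro mult_left_mono sum_le_suminf su) (use \<open>B \<ge> 0\<close> in auto)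
    finally show ?thesis .
  qed
  \<comment> \<open>Each digit contributes its multiple of the recurrence for \<open>u\<close>,
    started at k - Suc j; the coefficients \<open>q\<close> are the same for all starting
    points.\<close>
  have "(\<Sum>i<e. q i * U i) + U e
      = (\<Sum>j<k. of_int (x j) * ((\<Sum>i<e. q i * u (k - Suc j + i)) + u (k - Suc j + e)))"
    unfolding U_def sum_distrib_left distrib_left sum.distrib
    by (subst sum.swap) (simp add: algebra_simps)
  then show "(\<Sum>i<e. q i * U i) + U e = 0"
    by (simp only: q mult_zero_right sum.neutral_const)
qed

text \<open>The last coordinate is forced by the hyperplane equation satisfied by \<open>U\<close> above.\<close>

definition grid_centre :: "real \<Rightarrow> nat \<Rightarrow> (nat \<Rightarrow> real) \<Rightarrow> real \<Rightarrow> real \<Rightarrow> (nat \<Rightarrow> int) \<Rightarrow> nat \<Rightarrow> real" where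
  "grid_centre \<beta> e q c d w i =
    \<beta> ^ i * c - d * (if i < e then of_int (w i) else - (\<Sum>j<e. q j * of_int (w j)))"

text \<open>The first \<open>e\<close> coordinates of U are rounded down to multiples of d, at cost
  d each. The linear relation then determines the last one up to d * (\<Sum>i<e. |q i|), and moving
  s to c costs at most d * \<beta>^e. Only \<open>e\<close> coordinates are free, so there are (2 N
  + 1)^e centres.\<close>

lemma grid_centre_approx:
  assumes \<beta>: "\<beta> > 1" and d: "d > 0" and s: "\<bar>s - c\<bar> \<le> d" and U: "\<And>i. \<bar>U i\<bar> \<le> d * real N"
    and q: "(\<Sum>i<e. q i * U i) + U e = 0"
  shows "\<exists>w \<in> {..<e} \<rightarrow>\<^sub>E {- int N..int N}. \<forall>i\<le>e.
    \<bar>(\<beta> ^ i * s - U i) - grid_centre \<beta> e q c d w i\<bar> \<le> d * (\<beta> ^ e + 1 + (\<Sum>i<e. \<bar>q i\<bar>))"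
proof
  define w where "w = restrict (\<lambda>i. \<lfloor>U i / d\<rfloor>) {..<e}"
  have UN: "- real N \<le> U i / d" "U i / d < real N + 1" for i
  proof -
    have "d * real N < d * (real N + 1)" using d by simp
    then show "- real N \<le> U i / d" "U i / d < real N + 1"
      using U[of i] d by (auto simp: field_simps abs_le_iff)
  qed
  then show "w \<in> {..<e} \<rightarrow>\<^sub>E {- int N..int N}"
    unfolding w_def by (auto simp: le_floor_iff floor_le_iff intro: le_less_trans)
  have w: "\<bar>U i - d * of_int (w i)\<bar> \<le> d" if "i < e" for i
  proof -
    have "0 \<le> U i / d - of_int (w i)" "U i / d - of_int (w i) \<le> 1"
      using that of_int_floor_le[of "U i / d"] floor_correct[of "U i / d"] by (auto simp: w_def) linarith
    then have "0 \<le> d * (U i / d - of_int (w i))" "d * (U i / d - of_int (w i)) \<le> d * 1"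
      using d by (auto intro: mult_left_mono)
    then show ?thesis using d by (simp add: right_diff_distrib)
  qed
  have Q: "d * (\<Sum>i<e. \<bar>q i\<bar>) \<ge> 0" using d by (simp add: sum_nonneg)
  show "\<forall>i\<le>e. \<bar>(\<beta> ^ i * s - U i) - grid_centre \<beta> e q c d w i\<bar> \<le> d * (\<beta> ^ e + 1 + (\<Sum>i<e. \<bar>q i\<bar>))"
  proof (intro allI impI)
    fix i assume "i \<le> e"
    define V where "V = (if i < e then of_int (w i) else - (\<Sum>j<e. q j * of_int (w j)))"
    have "\<bar>U i - d * V\<bar> \<le> d * (1 + (\<Sum>i<e. \<bar>q i\<bar>))"
    proof (cases "i < e")
      case True
      then have "V = of_int (w i)" by (simp add: V_def)
      then have "\<bar>U i - d * V\<bar> \<le> d" using w[OF True] by simp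
      with Q show ?thesis unfolding distrib_left by linarith
    next
      case False
      with \<open>i \<le> e\<close> have "i = e" by simp
      then have "U i - d * V = - (\<Sum>j<e. q j * (U j - d * of_int (w j)))"
        using q by (simp add: V_def algebra_simps sum_subtractf sum_distrib_left)
      also have "\<bar>\<dots>\<bar> \<le> (\<Sum>j<e. \<bar>q j\<bar> * d)"
        unfolding abs_minus_cancel
        by (rule order_trans[OF sum_abs sum_mono]) (use w in \<open>auto simp: abs_mult intro: mult_left_mono\<close>)
      also have "\<dots> = d * (\<Sum>i<e. \<bar>q i\<bar>)"
        by (simp add: sum_distrib_left mult.commute)
      finally show ?thesis using d by (simp add: algebra_simps)
    qed
    moreover have "\<bar>\<beta> ^ i * (s - c)\<bar> \<le> \<beta> ^ e * d"
      unfolding abs_mult using s \<beta> \<open>i \<le> e\<close> by (intro mult_mono) (auto intro: power_increasing)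
    moreover have "(\<beta> ^ i * s - U i) - grid_centre \<beta> e q c d w i = \<beta> ^ i * (s - c) - (U i - d * V)"
      by (simp add: grid_centre_def V_def algebra_simps)
    moreover have "\<bar>\<beta> ^ i * (s - c) - (U i - d * V)\<bar> \<le> \<bar>\<beta> ^ i * (s - c)\<bar> + \<bar>U i - d * V\<bar>"
      by (rule abs_triangle_ineq4)
    ultimately show "\<bar>(\<beta> ^ i * s - U i) - grid_centre \<beta> e q c d w i\<bar> \<le> d * (\<beta> ^ e + 1 + (\<Sum>i<e. \<bar>q i\<bar>))"
      by (simp add: algebra_simps)
  qed
qed

section \<open>The Dirichlet kernel near integer points\<close>

definition frequencies :: "nat \<Rightarrow> nat \<Rightarrow> (nat \<Rightarrow> nat) set" where
  "frequencies n e = {..e} \<rightarrow>\<^sub>E {..<n}"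

text \<open>The product of e + 1 one-dimensional kernels with frequencies 0, ..., n - 1. Its squared
  modulus is n^(e+1) times the product of the Fejer kernels.\<close>

definition dirichlet_kernel :: "nat \<Rightarrow> nat \<Rightarrow> (nat \<Rightarrow> real) \<Rightarrow> complex" where
  "dirichlet_kernel n e \<theta> = (\<Sum>l\<in>frequencies n e. cis (- (2 * pi * (\<Sum>i\<le>e. real (l i) * \<theta> i))))"

lemma finite_frequencies: "finite (frequencies n e)"
  by (simp add: frequencies_def finite_PiE)

lemma card_frequencies: "card (frequencies n e) = n ^ Suc e"
  by (simp add: frequencies_def card_PiE)

lemma cos_ge_half_near_integer:
  assumes "y - r \<in> \<int>" "\<bar>r\<bar> \<le> 1 / 6"
  shows "cos (2 * pi * y) \<ge> 1 / 2"
proof -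
  obtain m where "y = r + of_int m"
    using assms(1) by (metis Ints_cases diff_eq_eq add.commute)
  then have "cos (2 * pi * y) = cos (2 * pi * r + 2 * pi * of_int m)"
    by (simp add: algebra_simps)
  also have "\<dots> = cos (2 * pi * r)"
    using cos_int_2pin sin_int_2pin by (simp add: cos_add)
  also have "\<dots> = cos \<bar>2 * pi * r\<bar>" by simp
  also have "\<dots> \<ge> cos (pi / 3)"
    using assms(2) by (intro cos_monotone_0_pi_le) (auto simp: abs_mult field_simps)
  finally show ?thesis by (simp add: cos_60)
qed

text \<open>If all coordinates are this close to integers, every phase is within a sixth of a turn
  of 0. Each of the n^(e+1) terms then has real part at least cos (pi / 3) = 1/2, and nothing
  cancels.\<close>

lemma norm_dirichlet_kernel_ge:
  assumes near: "\<And>i. i \<le> e \<Longrightarrow> \<exists>r. \<theta> i - r \<in> \<int> \<and> \<bar>r\<bar> \<le> h"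
    and h: "h * (real n * real (Suc e)) \<le> 1 / 6"
  shows "norm (dirichlet_kernel n e \<theta>) \<ge> real n ^ Suc e / 2"
proof -
  from near have "\<forall>i. \<exists>r. i \<le> e \<longrightarrow> \<theta> i - r \<in> \<int> \<and> \<bar>r\<bar> \<le> h" by blast
  then obtain r where r: "\<And>i. i \<le> e \<Longrightarrow> \<theta> i - r i \<in> \<int>" "\<And>i. i \<le> e \<Longrightarrow> \<bar>r i\<bar> \<le> h"
    by metis
  have "Re (cis (- (2 * pi * (\<Sum>i\<le>e. real (l i) * \<theta> i)))) \<ge> 1 / 2" if "l \<in> frequencies n e" for l
  proof -
    have l: "real (l i) \<le> real n" if "i \<le> e" for i
      using \<open>l \<in> _\<close> that PiE_mem[of l "{..e}" "\<lambda>_. {..<n}" i] by (simp add: frequencies_def)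
    have "(\<Sum>i\<le>e. real (l i) * \<theta> i) - (\<Sum>i\<le>e. real (l i) * r i) = (\<Sum>i\<le>e. real (l i) * (\<theta> i - r i))"
      by (simp add: algebra_simps sum_subtractf)
    also have "\<dots> \<in> \<int>" using r(1) by (intro Ints_sum Ints_mult) auto
    finally have 1: "(\<Sum>i\<le>e. real (l i) * \<theta> i) - (\<Sum>i\<le>e. real (l i) * r i) \<in> \<int>" .
    have "\<bar>\<Sum>i\<le>e. real (l i) * r i\<bar> \<le> (\<Sum>i\<le>e. real n * h)"
      by (rule order_trans[OF sum_abs sum_mono]) (use l r(2) in \<open>auto simp: abs_mult intro!: mult_mono\<close>)
    also have "\<dots> \<le> 1 / 6" using h by (simp add: algebra_simps)
    finally show ?thesis
      using cos_ge_half_near_integer[OF 1] by simp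
  qed
  then have "(\<Sum>l\<in>frequencies n e. 1 / 2) \<le> Re (dirichlet_kernel n e \<theta>)"
    unfolding dirichlet_kernel_def Re_sum by (rule sum_mono)
  also have "\<dots> \<le> norm (dirichlet_kernel n e \<theta>)" by (rule complex_Re_le_cmod)
  finally show ?thesis by (simp add: card_frequencies)
qed

section \<open>The decay condition implies absolute continuity\<close>

lemma norm_dirichlet_kernel_sq:
  "complex_of_real ((norm (dirichlet_kernel n e \<theta>))\<^sup>2) =
    (\<Sum>l\<in>frequencies n e. \<Sum>l'\<in>frequencies n e.
      cis (- (2 * pi * (\<Sum>i\<le>e. (real (l i) - real (l' i)) * \<theta> i))))"
proof -
  let ?c = "\<lambda>l. - (2 * pi * (\<Sum>i\<le>e. real (l i) * \<theta> i))"
  have "complex_of_real ((norm (dirichlet_kernel n e \<theta>))\<^sup>2)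
      = (\<Sum>l\<in>frequencies n e. cis (?c l)) * (\<Sum>l\<in>frequencies n e. cis (- ?c l))"
    unfolding complex_norm_square dirichlet_kernel_def cnj_sum cis_cnj ..
  also have "\<dots> = (\<Sum>l\<in>frequencies n e. \<Sum>l'\<in>frequencies n e. cis (?c l + - ?c l'))"
    by (simp only: sum_product cis_mult)
  finally show ?thesis
    by (simp add: left_diff_distrib sum_subtractf right_diff_distrib)
qed

lemma (in prob_space) integrable_bounded_complex:
  assumes "f \<in> borel_measurable M" "\<And>x. norm (f x :: complex) \<le> B"
  shows "integrable M f"
  by (rule integrable_const_bound[of _ B]) (use assms in auto)

text \<open>Expanding the square gives finitely many pairs of frequencies. The n^(e+1) diagonal
  pairs contribute 1 each; an off-diagonal pair contributes a Fourier coefficient at z * \<beta>^k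
  with z nonzero in Z[\<beta>], which tends to 0. The centre \<open>c\<close> enters only through
  unimodular factors.\<close>

lemma dirichlet_kernel_expectation:
  fixes \<nu> :: "real measure"
  assumes \<nu>: "prob_space \<nu>" "sets \<nu> = sets borel"
    and decay: "\<And>z. z \<in> Zbeta \<beta> - {0} \<Longrightarrow> (\<lambda>k. fourier \<nu> (z * \<beta> ^ k)) \<longlonglongrightarrow> 0"
    and indep: "\<And>m :: nat \<Rightarrow> int. (\<Sum>i\<le>e. of_int (m i) * \<beta> ^ i) = 0 \<Longrightarrow> \<forall>i\<le>e. m i = 0"
  shows "(\<lambda>k. \<integral>t. (norm (dirichlet_kernel n e (\<lambda>i. \<beta> ^ (k + i) * t - c i)))\<^sup>2 \<partial>\<nu>) \<longlonglongrightarrow> real n ^ Suc e"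
proof -
  interpret prob_space \<nu> by fact
  let ?L = "frequencies n e"
  let ?D = "\<lambda>k t. dirichlet_kernel n e (\<lambda>i. \<beta> ^ (k + i) * t - c i)"
  define z where "z l l' = (\<Sum>i\<le>e. (real (l i) - real (l' i)) * \<beta> ^ i)" for l l' :: "nat \<Rightarrow> nat"
  define C where "C l l' = cis (2 * pi * (\<Sum>i\<le>e. (real (l i) - real (l' i)) * c i))" for l l' :: "nat \<Rightarrow> nat"
  have meas: "(\<lambda>t. cis (- (2 * pi * t * r))) \<in> borel_measurable \<nu>" for r
    using borel_measurable_character[of r] measurable_cong_sets[OF \<nu>(2) refl] by blast
  have int: "integrable \<nu> (\<lambda>t. cis (- (2 * pi * t * r)))" for r
    by (rule integrable_bounded_complex[OF meas, of _ 1]) simp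
  have expand: "cis (- (2 * pi * (\<Sum>i\<le>e. (real (l i) - real (l' i)) * (\<beta> ^ (k + i) * t - c i))))
      = C l l' * cis (- (2 * pi * t * (z l l' * \<beta> ^ k)))" for k t l l'
  proof -
    have "(\<Sum>i\<le>e. (real (l i) - real (l' i)) * (\<beta> ^ (k + i) * t - c i))
       = t * (z l l' * \<beta> ^ k) - (\<Sum>i\<le>e. (real (l i) - real (l' i)) * c i)"
      unfolding z_def sum_distrib_left sum_distrib_right sum_subtractf[symmetric]
      by (intro sum.cong) (auto simp: power_add algebra_simps)
    then show ?thesis
      by (simp only: C_def cis_mult) (rule arg_cong[where f = cis], simp add: algebra_simps)
  qed
  have eq: "complex_of_real (\<integral>t. (norm (?D k t))\<^sup>2 \<partial>\<nu>)
      = (\<Sum>l\<in>?L. \<Sum>l'\<in>?L. C l l' * fourier \<nu> (z l l' * \<beta> ^ k))" for k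
  proof -
    have "complex_of_real (\<integral>t. (norm (?D k t))\<^sup>2 \<partial>\<nu>) = (\<integral>t. complex_of_real ((norm (?D k t))\<^sup>2) \<partial>\<nu>)"
      by (rule integral_complex_of_real[symmetric])
    also have "\<dots> = (\<integral>t. (\<Sum>l\<in>?L. \<Sum>l'\<in>?L. C l l' * cis (- (2 * pi * t * (z l l' * \<beta> ^ k)))) \<partial>\<nu>)"
      unfolding norm_dirichlet_kernel_sq expand ..
    also have "\<dots> = (\<Sum>l\<in>?L. \<Sum>l'\<in>?L. \<integral>t. C l l' * cis (- (2 * pi * t * (z l l' * \<beta> ^ k))) \<partial>\<nu>)"
      by (simp only: Bochner_Integration.integral_sum Bochner_Integration.integrable_sum integrable_mult_right int)
    finally show ?thesis
      by (simp only: fourier_def integral_mult_right_zero)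
  qed
  have lim: "(\<lambda>k. C l l' * fourier \<nu> (z l l' * \<beta> ^ k)) \<longlonglongrightarrow> (if l = l' then 1 else 0)"
    if "l \<in> ?L" "l' \<in> ?L" for l l'
  proof (cases "l = l'")
    case True
    then show ?thesis
      using prob_space by (simp add: C_def z_def fourier_def)
  next
    case False
    \<comment> \<open>Frequencies are extensional functions on {..e}, so distinct ones differ at an
      index that counts.\<close>
    have "\<exists>j\<le>e. l j \<noteq> l' j"
    proof (rule ccontr)
      assume "\<not> ?thesis"
      then have "l = l'"
        using that unfolding frequencies_def by (intro PiE_ext) auto
      with False show False ..
    qed
    then obtain j where "j \<le> e" "l j \<noteq> l' j" by blast
    let ?m = "\<lambda>i. int (l i) - int (l' i)"
    have z: "z l l' = (\<Sum>i\<le>e. of_int (?m i) * \<beta> ^ i)"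
      by (simp add: z_def)
    then have "z l l' \<noteq> 0"
      using indep[of ?m] \<open>j \<le> e\<close> \<open>l j \<noteq> l' j\<close> by auto
    moreover have "z l l' \<in> Zbeta \<beta>"
    proof -
      define r where "r = (\<Sum>i\<le>e. monom (?m i) i)"
      have "poly (map_poly real_of_int (\<Sum>i\<in>I. monom (?m i) i)) \<beta> = (\<Sum>i\<in>I. of_int (?m i) * \<beta> ^ i)"
        if "finite I" for I
        using that by (induction I) (simp_all add: poly_of_int_add map_poly_monom poly_monom del: of_int_diff)
      from this[of "{..e}"] have "poly (map_poly real_of_int r) \<beta> = z l l'"
        unfolding z r_def by simp
      from this[symmetric] show ?thesis unfolding Zbeta_def by blast
    qed
    ultimately have "(\<lambda>k. fourier \<nu> (z l l' * \<beta> ^ k)) \<longlonglongrightarrow> 0"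
      using decay by blast
    then show ?thesis
      using False tendsto_mult_right_zero by fastforce
  qed
  have "(\<lambda>k. \<Sum>l\<in>?L. \<Sum>l'\<in>?L. C l l' * fourier \<nu> (z l l' * \<beta> ^ k))
      \<longlonglongrightarrow> (\<Sum>l\<in>?L. \<Sum>l'\<in>?L. if l = l' then 1 else 0)"
    by (intro tendsto_sum lim)
  moreover have "(\<Sum>l\<in>?L. \<Sum>l'\<in>?L. if l = l' then 1 else (0::complex)) = of_real (real n ^ Suc e)"
    by (simp add: finite_frequencies card_frequencies)
  ultimately have "(\<lambda>k. complex_of_real (\<integral>t. (norm (?D k t))\<^sup>2 \<partial>\<nu>)) \<longlonglongrightarrow> of_real (real n ^ Suc e)"
    unfolding eq by simp
  then show ?thesis
    by (simp only: tendsto_of_real_iff)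
qed

section \<open>Interval bounds for the pushforward of the digit measure\<close>

context stationary_digits
begin

lemma phi_plus_measurable [measurable]: "phi_plus \<beta> \<in> borel_measurable \<mu>"
  unfolding phi_plus_def[abs_def] by measurable

text \<open>When the shifted point falls into the interval, one of the (2 N + 1)^e kernels has
  modulus at least n^(e+1) / 2. Integrating the squares and letting k tend to infinity bounds
  n^(2e+2) / 4 times the interval mass by (2 N + 1)^e * n^(e+1).\<close>

lemma interval_bound_scale:
  assumes \<beta>: "\<beta> > 1"
    and gu: "\<And>m. real_of_int (g m) = \<beta> ^ m + u m" and su: "summable (\<lambda>m. \<bar>u m\<bar>)"
    and q: "\<And>n. (\<Sum>i<e. q i * u (n + i)) + u (n + e) = 0"
    and indep: "\<And>m :: nat \<Rightarrow> int. (\<Sum>i\<le>e. of_int (m i) * \<beta> ^ i) = 0 \<Longrightarrow> \<forall>i\<le>e. m i = 0"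
    and B: "\<And>a. a \<in> A \<Longrightarrow> \<bar>real_of_int a\<bar> \<le> B"
    and decay: "\<And>z. z \<in> Zbeta \<beta> - {0} \<Longrightarrow> (\<lambda>k. fourier (distr \<mu> lborel (phi_plus \<beta>)) (z * \<beta> ^ k)) \<longlonglongrightarrow> 0"
    and n: "n > 0" and d: "d > 0" "d * (\<beta> ^ e + 1 + (\<Sum>i<e. \<bar>q i\<bar>)) * (real n * real (Suc e)) \<le> 1 / 6"
    and N: "B * (\<Sum>m. \<bar>u m\<bar>) \<le> d * real N"
  shows "prob {x. phi_plus \<beta> x \<in> {c - d..c + d}} \<le> 4 * (2 * real N + 1) ^ e / real n ^ Suc e"
proof -
  define \<nu> where "\<nu> = distr \<mu> lborel (phi_plus \<beta>)"
  let ?W = "{..<e} \<rightarrow>\<^sub>E {- int N..int N}"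
  let ?D = "\<lambda>w k t. dirichlet_kernel n e (\<lambda>i. \<beta> ^ (k + i) * t - grid_centre \<beta> e q c d w i)"
  have \<phi>: "phi_plus \<beta> \<in> measurable \<mu> lborel" by simp
  have \<nu>: "prob_space \<nu>" "sets \<nu> = sets borel"
    unfolding \<nu>_def by (auto intro: prob_space_distr)
  have finW: "finite ?W" by (simp add: finite_PiE)
  have cardW: "real (card ?W) = (2 * real N + 1) ^ e"
    by (simp add: card_PiE)
  define I where "I = {c - d..c + d}"
  have [measurable]: "{x. phi_plus \<beta> x \<in> I} \<in> sets \<mu>"
    using measurable_sets[OF phi_plus_measurable, of I] by (simp add: I_def vimage_def)
  have Dm: "(\<lambda>t. (norm (?D w k t))\<^sup>2) \<in> borel_measurable borel" for w k
    unfolding dirichlet_kernel_def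
    by (intro borel_measurable_continuous_onI continuous_intros)
  have Dbound: "norm (?D w k t) \<le> real n ^ Suc e" for w k t
  proof -
    have "norm (?D w k t) \<le> (\<Sum>l\<in>frequencies n e. 1)"
      unfolding dirichlet_kernel_def by (rule sum_norm_le) simp
    then show ?thesis by (simp add: card_frequencies)
  qed
  have Dint: "integrable \<mu> (\<lambda>x. (norm (?D w k (phi_plus \<beta> x)))\<^sup>2)" for w k
  proof (rule integrable_const_bound)
    show "AE x in \<mu>. norm ((norm (?D w k (phi_plus \<beta> x)))\<^sup>2) \<le> (real n ^ Suc e)\<^sup>2"
      using Dbound by (auto intro!: AE_I2 power_mono simp del: power_Suc)
    show "(\<lambda>x. (norm (?D w k (phi_plus \<beta> x)))\<^sup>2) \<in> borel_measurable \<mu>"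
      by (rule measurable_compose[OF phi_plus_measurable Dm])
  qed
  have Bx: "AE x in \<mu>. \<forall>j. \<bar>real_of_int (x j)\<bar> \<le> B"
    using AE_digits by eventually_elim (auto intro: B)
  have "(real n ^ Suc e)\<^sup>2 / 4 * prob {x. phi_plus \<beta> x \<in> I} \<le> (\<Sum>w\<in>?W. \<integral>t. (norm (?D w k t))\<^sup>2 \<partial>\<nu>)" for k
  proof -
    have shift: "prob {x. phi_plus \<beta> (\<lambda>i. x (i + k)) \<in> I} = prob {x. phi_plus \<beta> x \<in> I}"
    proof -
      have "prob {x. phi_plus \<beta> x \<in> I} = measure (distr \<mu> seq_space (\<lambda>x i. x (i + k))) {x. phi_plus \<beta> x \<in> I}"
        by (simp only: distr_shift_funpow)
      also have "\<dots> = prob {x. phi_plus \<beta> (\<lambda>i. x (i + k)) \<in> I}"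
        by (subst measure_distr) (auto simp: vimage_def sets_\<mu>[symmetric])
      finally show ?thesis ..
    qed
    have [measurable]: "{x. phi_plus \<beta> (\<lambda>i. x (i + k)) \<in> I} \<in> sets \<mu>"
    proof -
      have "{x. phi_plus \<beta> x \<in> I} \<in> sets seq_space" by (subst sets_\<mu>[symmetric]) measurable
      from measurable_sets[OF shift_measurable[of k] this] show ?thesis
        by (simp add: vimage_def)
    qed
    \<comment> \<open>The centre that works depends on x, so the squares are summed over all
      centres.\<close>
    have pointwise: "AE x in \<mu>. (real n ^ Suc e)\<^sup>2 / 4 * indicat_real {x. phi_plus \<beta> (\<lambda>i. x (i + k)) \<in> I} x
        \<le> (\<Sum>w\<in>?W. (norm (?D w k (phi_plus \<beta> x)))\<^sup>2)"
      using Bx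
    proof eventually_elim
      case (elim x)
      show ?case
      proof (cases "phi_plus \<beta> (\<lambda>i. x (i + k)) \<in> I")
        case True
        have xB: "\<bar>real_of_int (x j)\<bar> \<le> B" for j using elim by blast
        obtain U where U: "\<And>i. \<beta> ^ (k + i) * phi_plus \<beta> x - (\<beta> ^ i * phi_plus \<beta> (\<lambda>j. x (j + k)) - U i) \<in> \<int>"
          "\<And>i. \<bar>U i\<bar> \<le> B * (\<Sum>m. \<bar>u m\<bar>)" "(\<Sum>i<e. q i * U i) + U e = 0"
          using expansion_mod_integers[where x = x and k = k, OF \<beta> xB gu su q] by blast
        have "\<bar>U i\<bar> \<le> d * real N" for i
          using U(2)[of i] N by simp
        moreover have "\<bar>phi_plus \<beta> (\<lambda>j. x (j + k)) - c\<bar> \<le> d"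
          using True by (auto simp: I_def)
        ultimately obtain w where w: "w \<in> ?W"
          "\<And>i. i \<le> e \<Longrightarrow> \<bar>(\<beta> ^ i * phi_plus \<beta> (\<lambda>j. x (j + k)) - U i) - grid_centre \<beta> e q c d w i\<bar>
             \<le> d * (\<beta> ^ e + 1 + (\<Sum>i<e. \<bar>q i\<bar>))"
          using grid_centre_approx[OF \<beta> d(1) _ _ U(3), of "phi_plus \<beta> (\<lambda>j. x (j + k))" c N] by blast
        have "real n ^ Suc e / 2 \<le> norm (?D w k (phi_plus \<beta> x))"
        proof (rule norm_dirichlet_kernel_ge[OF _ d(2)])
          fix i assume "i \<le> e"
          let ?r = "(\<beta> ^ i * phi_plus \<beta> (\<lambda>j. x (j + k)) - U i) - grid_centre \<beta> e q c d w i"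
          have "\<beta> ^ (k + i) * phi_plus \<beta> x - grid_centre \<beta> e q c d w i - ?r \<in> \<int>"
            using U(1)[of i] by (simp add: algebra_simps)
          with w(2)[OF \<open>i \<le> e\<close>]
          show "\<exists>r. \<beta> ^ (k + i) * phi_plus \<beta> x - grid_centre \<beta> e q c d w i - r \<in> \<int> \<and>
              \<bar>r\<bar> \<le> d * (\<beta> ^ e + 1 + (\<Sum>i<e. \<bar>q i\<bar>))" by blast
        qed
        then have "(real n ^ Suc e / 2)\<^sup>2 \<le> (norm (?D w k (phi_plus \<beta> x)))\<^sup>2"
          by (rule power_mono) simp
        also have "\<dots> \<le> (\<Sum>w\<in>?W. (norm (?D w k (phi_plus \<beta> x)))\<^sup>2)"
          by (rule member_le_sum[OF w(1)]) (use finW in auto)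
        finally show ?thesis using True by (simp add: power_divide del: power_Suc)
      next
        case False
        then show ?thesis by (simp add: sum_nonneg)
      qed
    qed
    have "(real n ^ Suc e)\<^sup>2 / 4 * prob {x. phi_plus \<beta> x \<in> I}
        = (\<integral>x. (real n ^ Suc e)\<^sup>2 / 4 * indicat_real {x. phi_plus \<beta> (\<lambda>i. x (i + k)) \<in> I} x \<partial>\<mu>)"
      using shift by simp
    also have "\<dots> \<le> (\<integral>x. (\<Sum>w\<in>?W. (norm (?D w k (phi_plus \<beta> x)))\<^sup>2) \<partial>\<mu>)"
      by (rule integral_mono_AE[OF _ _ pointwise])
        (auto intro!: Bochner_Integration.integrable_sum Dint integrable_mult_right integrable_real_indicator
          simp: emeasure_eq_measure)
    also have "\<dots> = (\<Sum>w\<in>?W. \<integral>x. (norm (?D w k (phi_plus \<beta> x)))\<^sup>2 \<partial>\<mu>)"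
      by (simp only: Bochner_Integration.integral_sum Dint)
    also have "\<dots> = (\<Sum>w\<in>?W. \<integral>t. (norm (?D w k t))\<^sup>2 \<partial>\<nu>)"
      unfolding \<nu>_def using Dm by (intro sum.cong refl integral_distr[symmetric] \<phi>) simp
    finally show ?thesis .
  qed
  moreover have "(\<lambda>k. \<Sum>w\<in>?W. \<integral>t. (norm (?D w k t))\<^sup>2 \<partial>\<nu>) \<longlonglongrightarrow> (\<Sum>w\<in>?W. real n ^ Suc e)"
    by (intro tendsto_sum dirichlet_kernel_expectation[OF \<nu> _ indep]) (use decay in \<open>simp add: \<nu>_def\<close>)
  ultimately have "(real n ^ Suc e)\<^sup>2 / 4 * prob {x. phi_plus \<beta> x \<in> I} \<le> (\<Sum>w\<in>?W. real n ^ Suc e)"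
    by (intro LIMSEQ_le_const) auto
  also have "\<dots> = (2 * real N + 1) ^ e * real n ^ Suc e"
    unfolding sum_constant cardW ..
  finally have "real n ^ Suc e * (real n ^ Suc e * prob {x. phi_plus \<beta> x \<in> I}) \<le> real n ^ Suc e * (4 * (2 * real N + 1) ^ e)"
    by (simp add: power2_eq_square del: power_Suc) (simp add: mult_ac del: power_Suc)
  then have "real n ^ Suc e * prob {x. phi_plus \<beta> x \<in> I} \<le> 4 * (2 * real N + 1) ^ e"
    by (rule mult_left_le_imp_le) (use n in simp)
  then show ?thesis
    unfolding I_def using n by (subst pos_le_divide_eq) (simp_all add: mult.commute)
qed

lemma absolutely_continuous_if_decay:
  assumes pis: "pisot \<beta>"
    and decay: "\<And>z. z \<in> Zbeta \<beta> - {0} \<Longrightarrow> (\<lambda>k. fourier (distr \<mu> lborel (phi_plus \<beta>)) (z * \<beta> ^ k)) \<longlonglongrightarrow> 0"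
  shows "absolutely_continuous lborel (distr \<mu> lborel (phi_plus \<beta>))"
proof -
  have \<beta>: "\<beta> > 1" using pis by (simp add: pisot_def)
  obtain e :: nat and g :: "nat \<Rightarrow> int" and u q :: "nat \<Rightarrow> real" where seq: "\<And>m. real_of_int (g m) = \<beta> ^ m + u m" "summable (\<lambda>m. \<bar>u m\<bar>)"
    "\<And>n. (\<Sum>i<e. q i * u (n + i)) + u (n + e) = 0"
    "\<And>m :: nat \<Rightarrow> int. (\<Sum>i\<le>e. of_int (m i) * \<beta> ^ i) = 0 \<Longrightarrow> \<forall>i\<le>e. m i = 0"
    using pisot_trace_sequence[OF pis] by blast
  define B where "B = (\<Sum>a\<in>A. \<bar>real_of_int a\<bar>)"
  have B: "\<bar>real_of_int a\<bar> \<le> B" if "a \<in> A" for a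
    unfolding B_def by (rule member_le_sum[OF that]) (use finite_A in auto)
  have "B \<ge> 0" by (simp add: B_def sum_nonneg)
  define R where "R = B * (\<Sum>m. \<bar>u m\<bar>)"
  have "R \<ge> 0" unfolding R_def using \<open>B \<ge> 0\<close> seq(2) by (intro mult_nonneg_nonneg suminf_nonneg) auto
  define K where "K = \<beta> ^ e + 1 + (\<Sum>i<e. \<bar>q i\<bar>)"
  have "\<beta> ^ e \<ge> 0" using \<beta> by simp
  moreover have "(\<Sum>i<e. \<bar>q i\<bar>) \<ge> 0" by (simp add: sum_nonneg)
  ultimately have "K \<ge> 1" unfolding K_def by linarith
  \<comment> \<open>Chosen so that d = 1 / (n * L) meets the smallness condition of the kernel bound
    with equality: d * K * n * (e + 1) = 1/6.\<close>
  define L where "L = 6 * real (Suc e) * K"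
  have "L \<ge> 6 * 1 * 1" unfolding L_def using \<open>K \<ge> 1\<close> by (intro mult_mono) auto
  then have L: "L \<ge> 1" by simp
  \<comment> \<open>With N = \<lceil>R / d\<rceil> at most R * L * n + 1, the number 2 N + 1 of grid
    values per coordinate is at most 2 R L n + 3, hence at most C * n.\<close>
  define C where "C = 2 * R * L + 3"
  have "C \<ge> 0" using \<open>R \<ge> 0\<close> L by (simp add: C_def)
  have scale: "prob {x. phi_plus \<beta> x \<in> {c - h..c + h}} \<le> 4 * C ^ e / real n"
    if "n > 0" "h \<le> 1 / (real n * L)" for n :: nat and c h
  proof -
    define d where "d = 1 / (real n * L)"
    have "d > 0" using that L by (simp add: d_def)
    define N where "N = nat \<lceil>R / d\<rceil>"
    have N: "R \<le> d * real N"
    proof -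
      have "R / d \<le> real N" unfolding N_def by linarith
      then show ?thesis using \<open>d > 0\<close> by (simp add: field_simps)
    qed
    have "real N \<le> R / d + 1"
      unfolding N_def using \<open>R \<ge> 0\<close> \<open>d > 0\<close> by simp
    then have "2 * real N + 1 \<le> 2 * R * L * real n + 3 * 1"
      by (simp add: d_def algebra_simps)
    also have "\<dots> \<le> 2 * R * L * real n + 3 * real n"
      using that by (intro add_left_mono mult_left_mono) auto
    finally have NC: "2 * real N + 1 \<le> C * real n"
      by (simp add: C_def algebra_simps)
    have "prob {x. phi_plus \<beta> x \<in> {c - h..c + h}} \<le> prob {x. phi_plus \<beta> x \<in> {c - d..c + d}}"
    proof (rule finite_measure_mono)
      show "{x. phi_plus \<beta> x \<in> {c - d..c + d}} \<in> sets \<mu>"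
        using measurable_sets[OF phi_plus_measurable, of "{c - d..c + d}"] by (simp add: vimage_def)
    qed (use that in \<open>auto simp: d_def\<close>)
    also have "\<dots> \<le> 4 * (2 * real N + 1) ^ e / real n ^ Suc e"
    proof (rule interval_bound_scale[OF \<beta> seq B decay \<open>n > 0\<close> \<open>d > 0\<close>])
      show "d * (\<beta> ^ e + 1 + (\<Sum>i<e. \<bar>q i\<bar>)) * (real n * real (Suc e)) \<le> 1 / 6"
        unfolding K_def[symmetric] d_def L_def using that \<open>K \<ge> 1\<close> by (simp add: field_simps)
      show "B * (\<Sum>m. \<bar>u m\<bar>) \<le> d * real N" using N by (simp add: R_def)
    qed
    also have "\<dots> \<le> 4 * (C * real n) ^ e / real n ^ Suc e"
      using NC by (intro divide_right_mono mult_left_mono power_mono) auto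
    also have "\<dots> = 4 * C ^ e / real n"
      using that by (simp add: power_mult_distrib field_simps)
    finally show ?thesis .
  qed
  \<comment> \<open>The summand L serves long intervals, where the trivial bound 1 on the mass
    suffices; the other serves short ones.\<close>
  define M where "M = L + 4 * C ^ e * L"
  have "M \<ge> 0" using L \<open>C \<ge> 0\<close> by (simp add: M_def)
  have bound: "prob {x. phi_plus \<beta> x \<in> {a..b}} \<le> M * (b - a)" if "a < b" for a b
  proof -
    define h c where "h = (b - a) / 2" and "c = (a + b) / 2"
    have "h > 0" and ab: "{a..b} = {c - h..c + h}" "b - a = 2 * h"
      using that by (auto simp: h_def c_def field_simps)
    have CL: "4 * C ^ e * L * (2 * h) \<ge> 0" "L * (2 * h) \<ge> 0"
      using \<open>h > 0\<close> L \<open>C \<ge> 0\<close> by auto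
    show ?thesis
    proof (cases "h * L \<ge> 1")
      case True
      then have "1 \<le> L * (2 * h)" using \<open>h > 0\<close> by (simp add: algebra_simps)
      with CL prob_le_1[of "{x. phi_plus \<beta> x \<in> {a..b}}"] show ?thesis
        unfolding ab(2) M_def distrib_right by linarith
    next
      case False
      \<comment> \<open>The scale condition h <= 1 / (n * L) reads n <= y. Rounding y > 1 down to n
        keeps n positive and loses at most a factor 2, so 1 / n is at most L * (b - a).\<close>
      define y where "y = 1 / (h * L)"
      have "y > 1" using False \<open>h > 0\<close> L by (simp add: y_def)
      define n where "n = nat \<lfloor>y\<rfloor>"
      have "\<lfloor>y\<rfloor> \<ge> 1" using \<open>y > 1\<close> by (simp add: le_floor_iff)
      then have "n > 0" and rn: "real n = of_int \<lfloor>y\<rfloor>" by (simp_all add: n_def)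
      then have n: "real n \<le> y" "y \<le> 2 * real n" "n > 0"
        using \<open>\<lfloor>y\<rfloor> \<ge> 1\<close> by linarith+
      have hL: "h * L > 0" using \<open>h > 0\<close> L by simp
      have "real n * (h * L) \<le> 1"
        using n(1) hL by (simp add: y_def field_simps)
      then have "h \<le> 1 / (real n * L)"
        using n(3) L by (simp add: field_simps)
      then have "prob {x. phi_plus \<beta> x \<in> {a..b}} \<le> 4 * C ^ e / real n"
        unfolding ab(1) using scale n(3) by blast
      also have "\<dots> = 4 * C ^ e * (1 / real n)" by simp
      also have "1 \<le> 2 * real n * (h * L)"
        using n(2) hL by (simp add: y_def field_simps)
      then have "4 * C ^ e * (1 / real n) \<le> 4 * C ^ e * (L * (2 * h))"
        using n(3) \<open>C \<ge> 0\<close> by (intro mult_left_mono) (auto simp: field_simps)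
      finally show ?thesis
        using CL unfolding ab(2) M_def by (simp add: algebra_simps)
    qed
  qed
  show ?thesis
  proof (rule absolutely_continuous_if_le_interval[OF _ _ \<open>M \<ge> 0\<close>])
    fix a b :: real assume "a < b"
    have "emeasure (distr \<mu> lborel (phi_plus \<beta>)) {a..b} = prob {x. phi_plus \<beta> x \<in> {a..b}}"
      by (subst emeasure_distr) (auto simp: vimage_def emeasure_eq_measure)
    also have "\<dots> \<le> ennreal (M * (b - a))"
      using bound[OF \<open>a < b\<close>] by (rule ennreal_leI)
    finally show "emeasure (distr \<mu> lborel (phi_plus \<beta>)) {a..b} \<le> ennreal (M * (b - a))" .
  qed simp
qed

end

lemma filterlim_abs_mult_power:
  fixes z \<beta> :: real
  assumes "\<beta> > 1" "z \<noteq> 0"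
  shows "filterlim (\<lambda>k. \<bar>z * \<beta> ^ k\<bar>) at_top sequentially"
proof -
  have "filterlim (\<lambda>k. z * \<beta> ^ k) at_infinity sequentially"
    using assms by (intro tendsto_mult_filterlim_at_infinity[OF tendsto_const] filterlim_realpow_sequentially_gt1) auto
  then show ?thesis
    using filterlim_at_infinity_imp_norm_at_top by fastforce
qed

section \<open>Weights of words in the labelled graph\<close>

lemma foldl_row_mult_linear:
  "foldl (\<lambda>u a. row_mult u (P a)) (\<lambda>i. \<Sum>a\<in>S. f a i) ws
    = (\<lambda>i. \<Sum>a\<in>S. foldl (\<lambda>u a. row_mult u (P a)) (f a) ws i)"
proof (induction ws arbitrary: f)
  case (Cons b ws)
  have "row_mult (\<lambda>i. \<Sum>a\<in>S. f a i) (P b) = (\<lambda>i. \<Sum>a\<in>S. row_mult (f a) (P b) i)"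
    unfolding row_mult_def by (subst sum.swap) (simp add: sum_distrib_right)
  then show ?case using Cons by simp
qed simp

lemma foldl_row_mult_scale:
  "foldl (\<lambda>u a. row_mult u (P a)) (\<lambda>i. c * f i) ws = (\<lambda>i. c * foldl (\<lambda>u a. row_mult u (P a)) f ws i)"
proof (induction ws arbitrary: f)
  case (Cons b ws)
  have "row_mult (\<lambda>i. c * f i) (P b) = (\<lambda>i. c * row_mult f (P b) i)"
    unfolding row_mult_def by (simp add: sum_distrib_left mult.assoc)
  then show ?case using Cons by simp
qed simp

lemma foldl_row_mult_nonneg:
  assumes "\<And>i. f i \<ge> 0"
  shows "foldl (\<lambda>u a. row_mult u (label_mat E lab a)) f ws i \<ge> 0"
  using assms
proof (induction ws arbitrary: f)
  case (Cons b ws)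
  have "row_mult f (label_mat E lab b) i \<ge> 0" for i
    unfolding row_mult_def label_mat_def using Cons(2) by (intro sum_nonneg) auto
  then show ?case using Cons(1) by simp
qed simp

text \<open>The front letter acts on \<open>vL\<close> before all others. Summing over it replaces
  \<open>vL\<close> by its product with the total matrix, that is by \<open>lam\<close> times
  \<open>vL\<close>, and linearity carries the factor through the rest of the word.\<close>

lemma sum_word_weight_Cons:
  assumes "row_mult vL (total_mat A E lab) = (\<lambda>i. lam * vL i)"
  shows "(\<Sum>a\<in>A. word_weight E lab vL vR (a # ws)) = lam * word_weight E lab vL vR ws"
proof -
  have "(\<lambda>i. \<Sum>a\<in>A. row_mult vL (label_mat E lab a) i) = (\<lambda>i. lam * vL i)"
    unfolding assms[symmetric] row_mult_def total_mat_def
    by (subst sum.swap) (simp add: sum_distrib_left)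
  then have "foldl (\<lambda>u a. row_mult u (label_mat E lab a)) (\<lambda>i. \<Sum>a\<in>A. row_mult vL (label_mat E lab a) i) ws
      = (\<lambda>i. lam * foldl (\<lambda>u a. row_mult u (label_mat E lab a)) vL ws i)"
    by (simp add: foldl_row_mult_scale)
  then have "(\<Sum>a\<in>A. foldl (\<lambda>u a. row_mult u (label_mat E lab a)) (row_mult vL (label_mat E lab a)) ws i)
      = lam * foldl (\<lambda>u a. row_mult u (label_mat E lab a)) vL ws i" for i
    unfolding foldl_row_mult_linear by (rule fun_cong)
  then show ?thesis
    unfolding word_weight_def
    by (subst sum.swap) (simp add: sum_distrib_right[symmetric] sum_distrib_left mult.assoc)
qed

theorem theorem14:
  fixes A :: "int set" and E :: "('v::finite \<times> 'v) set" and lab :: "'v \<times> 'v \<Rightarrow> int"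
    and \<beta> lam :: real and vL vR :: "'v \<Rightarrow> real" and \<mu> :: "(nat \<Rightarrow> int) measure"
  assumes finA: "finite A"
    and labA: "\<forall>e\<in>E. lab e \<in> A"
    and prim: "primitive_mat (total_mat A E lab)"
    and pis: "pisot \<beta>"
    and lam_pos: "lam > 0"
    and vL_pos: "\<forall>i. vL i > 0" and vR_pos: "\<forall>i. vR i > 0"
    and vL_eig: "row_mult vL (total_mat A E lab) = (\<lambda>i. lam * vL i)"
    and vR_eig: "\<forall>i. (\<Sum>j\<in>UNIV. total_mat A E lab i j * vR j) = lam * vR i"
    and norm: "(\<Sum>i\<in>UNIV. vL i * vR i) = 1"
    and sets_mu: "sets \<mu> = sets seq_space"
    and mu_prob: "prob_space \<mu>"
    and mu_cyl: "\<forall>ws. emeasure \<mu> {x \<in> space \<mu>. \<forall>i<length ws. x i = ws ! i}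
                   = ennreal (word_weight E lab vL vR ws / lam ^ length ws)"
  shows "absolutely_continuous lborel (distr \<mu> lborel (phi_plus \<beta>)) \<longleftrightarrow>
         (\<forall>z\<in>Zbeta \<beta> - {0}. ((\<lambda>k. fourier (distr \<mu> lborel (phi_plus \<beta>)) (z * \<beta> ^ k)) \<longlongrightarrow> 0) sequentially)"
proof -
  interpret prob_space \<mu> by (rule mu_prob)
  have space: "space \<mu> = UNIV"
    using sets_eq_imp_space_eq[OF sets_mu] by simp
  interpret stationary_digits \<mu> A "\<lambda>ws. word_weight E lab vL vR ws / lam ^ length ws"
  proof
    show "word_weight E lab vL vR ws / lam ^ length ws \<ge> 0" for ws
      unfolding word_weight_def using lam_pos vL_pos vR_pos
      by (intro divide_nonneg_nonneg sum_nonneg mult_nonneg_nonneg foldl_row_mult_nonneg) (auto intro: less_imp_le)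
    show "emeasure \<mu> (cylinder ws) = ennreal (word_weight E lab vL vR ws / lam ^ length ws)" for ws
      using mu_cyl space by (simp add: cylinder_def)
    \<comment> \<open>The extra power of \<open>lam\<close> for the longer word cancels the
      eigenvalue.\<close>
    show "(\<Sum>a\<in>A. word_weight E lab vL vR (a # ws) / lam ^ length (a # ws)) = word_weight E lab vL vR ws / lam ^ length ws" for ws
      using sum_word_weight_Cons[OF vL_eig, of vR ws] lam_pos by (simp flip: sum_divide_distrib)
  qed (use sets_mu finA in auto)
  have "\<beta> > 1" using pis by (simp add: pisot_def)
  show ?thesis
  proof (intro iffI ballI)
    fix z assume "absolutely_continuous lborel (distr \<mu> lborel (phi_plus \<beta>))" "z \<in> Zbeta \<beta> - {0}"
    then show "(\<lambda>k. fourier (distr \<mu> lborel (phi_plus \<beta>)) (z * \<beta> ^ k)) \<longlonglongrightarrow> 0"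
      using \<open>\<beta> > 1\<close>
      by (intro fourier_tendsto_0_if_absolutely_continuous filterlim_abs_mult_power prob_space_distr) auto
  next
    assume "\<forall>z\<in>Zbeta \<beta> - {0}. (\<lambda>k. fourier (distr \<mu> lborel (phi_plus \<beta>)) (z * \<beta> ^ k)) \<longlonglongrightarrow> 0"
    then show "absolutely_continuous lborel (distr \<mu> lborel (phi_plus \<beta>))"
      by (intro absolutely_continuous_if_decay[OF pis]) blast
  qed
qed

end
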